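(* Let $\alpha>1$, $\beta>0$, $\varphi,\psi\in S(\mathbb{D})$ and $u,v\in H(\mathbb{D})$. Suppose that $$\sup_{z\in\mathbb{D}}\frac{|U(z)|\,\rho(z)}{(1-|\varphi(z)|^2)^{\alpha-1}}<\infty\quad\text{and}\quad \sup_{z\in\mathbb{D}}\frac{|V(z)|\,\rho(z)}{(1-|\psi(z)|^2)^{\alpha-1}}<\infty .$$ Then $uC_\varphi-vC_\psi$ is bounded from $\mathcal{B}^\alpha$ to $\mathcal{B}^\beta$ if and only if all of the following conditions hold: (i) $D_{u,\varphi}=D_{v,\psi}$. (ii) $\sup_{z\in\mathbb{D}}|u(z)\varphi^\sharp(z)-v(z)\psi^\sharp(z)|<\infty$. (iii) (a) $\sup_{z\in\mathbb{D}}|u(z)\varphi^\sharp(z)|\,\rho(z)<\infty$, and (b) $\sup_{z\in\mathbb{D}}|v(z)\psi^\sharp(z)|\,\rho(z)<\infty$. (iv) $E_{u,\varphi}=E_{v,\psi}$. (v) (a) $\displaystyle\sup_{\{z_n\}\in E_{u,\varphi}}\limsup_{n\to\infty}\frac{|U(z_n)-V(z_n)|}{(1-|\varphi(z_n)|^2)^{\alpha-1}}<\infty$, and (b) $\displaystyle\sup_{\{z_n\}\in E_{v,\psi}}\limsup_{n\to\infty}\frac{|U(z_n)-V(z_n)|}{(1-|\psi(z_n)|^2)^{\alpha-1}}<\infty$. (vi) (a) $\displaystyle\sup_{\{z_n\}\in E_{u,\varphi}}\limsup_{n\to\infty}|U(z_n)|\,d_\alpha(z_n)<\infty$, and (b)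 $\displaystyle\sup_{\{z_n\}\in E_{v,\psi}}\limsup_{n\to\infty}|V(z_n)|\,d_\alpha(z_n)<\infty$. (A supremum over an empty set of sequences is regarded as finite.)
   Context: $\mathbb{D}$ is the open unit disk in $\mathbb{C}$, $H(\mathbb{D})$ the set of analytic functions on $\mathbb{D}$, and $S(\mathbb{D})$ the set of analytic self-maps of $\mathbb{D}$. For $u\in H(\mathbb{D})$, $\varphi\in S(\mathbb{D})$, the weighted composition operator is $(uC_\varphi)f(z)=u(z)f(\varphi(z))$, $f\in H(\mathbb{D})$. For $0<\alpha<\infty$, $\mathcal{B}^\alpha$ is the Banach space of all $f\in H(\mathbb{D})$ with $\|f\|_\alpha=\sup_{z\in\mathbb{D}}(1-|z|^2)^\alpha|f'(z)|<\infty$, normed by $\|f\|_{\mathcal{B}^\alpha}=|f(0)|+\|f\|_\alpha$; $\mathcal{B}^\beta$ is defined likewise. Notation, for fixed $\alpha,\beta,\varphi,\psi,u,v$: - $\varphi^\sharp(z)=\dfrac{(1-|z|^2)^\beta}{(1-|\varphi(z)|^2)^\alpha}\varphi'(z)$ and $\psi^\sharp(z)=\dfrac{(1-|z|^2)^\beta}{(1-|\psi(z)|^2)^\alpha}\psi'(z)$. - $U(z)=(1-|z|^2)^\beta u'(z)$ and $V(z)=(1-|z|^2)^\beta v'(z)$. - $\rho(z)=\left|\dfrac{\varphi(z)-\psi(z)}{1-\overline{\varphi(z)}\psi(z)}\right|$ (the pseudo-hyperbolic distance between $\varphi(z)$ and $\psi(z)$). - $d_\alpha(z,w)=\sup\{|f(z)-f(w)|:\|f\|_{\mathcal{B}^\alpha}\le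 1\}$ for $z,w\in\mathbb{D}$, and $d_\alpha(z)=d_\alpha(\varphi(z),\psi(z))$. - $D_{u,\varphi}$ is the set of all sequences $\{z_n\}$ in $\mathbb{D}$ with $|z_n|\to1$ and $|u(z_n)\varphi^\sharp(z_n)|\to\infty$; $D_{v,\psi}$ is the set of all sequences $\{z_n\}$ in $\mathbb{D}$ with $|z_n|\to1$ and $|v(z_n)\psi^\sharp(z_n)|\to\infty$. - $E_{u,\varphi}$ is the set of all sequences $\{z_n\}$ in $\mathbb{D}$ with $|z_n|\to1$ and $\dfrac{|U(z_n)|}{(1-|\varphi(z_n)|^2)^{\alpha-1}}\to\infty$; $E_{v,\psi}$ is the set of all sequences $\{z_n\}$ in $\mathbb{D}$ with $|z_n|\to1$ and $\dfrac{|V(z_n)|}{(1-|\psi(z_n)|^2)^{\alpha-1}}\to\infty$. *)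

theory Defs
  imports "HOL-Complex_Analysis.Complex_Analysis"
begin

abbreviation unit_disk :: "complex set" where
  "unit_disk \<equiv> ball 0 1"

text \<open>
  \<open>H(D)\<close> consists of the functions \<open>f\<close> with \<open>f holomorphic_on unit_disk\<close>. All functions are total on
  the complex numbers; their values outside the disk never enter any of the notions below.
\<close>

definition self_maps :: "(complex \<Rightarrow> complex) set" where
  "self_maps = {\<phi>. \<phi> holomorphic_on unit_disk \<and> \<phi> ` unit_disk \<subseteq> unit_disk}"

definition weighted_comp ::
    "(complex \<Rightarrow> complex) \<Rightarrow> (complex \<Rightarrow> complex) \<Rightarrow> (complex \<Rightarrow> complex) \<Rightarrow> complex \<Rightarrow> complex" where
  "weighted_comp u \<phi> f = (\<lambda>z. u z * f (\<phi> z))"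

definition bloch_space :: "real \<Rightarrow> (complex \<Rightarrow> complex) set" where
  "bloch_space \<alpha> = {f. f holomorphic_on unit_disk \<and>
     bdd_above ((\<lambda>z. (1 - (norm z)\<^sup>2) powr \<alpha> * norm (deriv f z)) ` unit_disk)}"

text \<open>The real supremum below is only meaningful for members of \<open>bloch_space \<alpha>\<close>.\<close>

definition bloch_seminorm :: "real \<Rightarrow> (complex \<Rightarrow> complex) \<Rightarrow> real" where
  "bloch_seminorm \<alpha> f = (SUP z\<in>unit_disk. (1 - (norm z)\<^sup>2) powr \<alpha> * norm (deriv f z))"

definition bloch_norm :: "real \<Rightarrow> (complex \<Rightarrow> complex) \<Rightarrow> real" where
  "bloch_norm \<alpha> f = norm (f 0) + bloch_seminorm \<alpha> f"

definition bloch_bounded ::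
    "real \<Rightarrow> real \<Rightarrow> ((complex \<Rightarrow> complex) \<Rightarrow> complex \<Rightarrow> complex) \<Rightarrow> bool" where
  "bloch_bounded \<alpha> \<beta> T \<longleftrightarrow>
     (\<exists>C. \<forall>f\<in>bloch_space \<alpha>. T f \<in> bloch_space \<beta> \<and> bloch_norm \<beta> (T f) \<le> C * bloch_norm \<alpha> f)"

definition sharp :: "real \<Rightarrow> real \<Rightarrow> (complex \<Rightarrow> complex) \<Rightarrow> complex \<Rightarrow> complex" where
  "sharp \<alpha> \<beta> \<phi> z =
     of_real ((1 - (norm z)\<^sup>2) powr \<beta> / (1 - (norm (\<phi> z))\<^sup>2) powr \<alpha>) * deriv \<phi> z"

text \<open>\<open>weighted_deriv \<beta> u\<close> and \<open>weighted_deriv \<beta> v\<close> are the functions \<open>U\<close> and \<open>V\<close>.\<close>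

definition weighted_deriv :: "real \<Rightarrow> (complex \<Rightarrow> complex) \<Rightarrow> complex \<Rightarrow> complex" where
  "weighted_deriv \<beta> u z = of_real ((1 - (norm z)\<^sup>2) powr \<beta>) * deriv u z"

definition pseudo_hyp_dist :: "complex \<Rightarrow> complex \<Rightarrow> real" where
  "pseudo_hyp_dist z w = norm ((z - w) / (1 - cnj z * w))"

text \<open>
  Suprema that are not known to be finite beforehand are taken in the extended reals, where the
  supremum of the empty set is \<open>-\<infinity>\<close> and hence satisfies \<open>< \<infinity>\<close>.
\<close>

definition bloch_dist :: "real \<Rightarrow> complex \<Rightarrow> complex \<Rightarrow> ereal" where
  "bloch_dist \<alpha> z w =
     (SUP f\<in>{f \<in> bloch_space \<alpha>. bloch_norm \<alpha> f \<le> 1}. ereal (norm (f z - f w)))"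

definition boundary_seqs_infinity :: "(complex \<Rightarrow> real) \<Rightarrow> (nat \<Rightarrow> complex) set" where
  "boundary_seqs_infinity h = {s. (\<forall>n. s n \<in> unit_disk) \<and> (\<lambda>n. norm (s n)) \<longlonglongrightarrow> 1 \<and>
     filterlim (\<lambda>n. h (s n)) at_top sequentially}"

definition D_seqs ::
    "real \<Rightarrow> real \<Rightarrow> (complex \<Rightarrow> complex) \<Rightarrow> (complex \<Rightarrow> complex) \<Rightarrow> (nat \<Rightarrow> complex) set" where
  "D_seqs \<alpha> \<beta> u \<phi> = boundary_seqs_infinity (\<lambda>z. norm (u z * sharp \<alpha> \<beta> \<phi> z))"

definition E_seqs ::
    "real \<Rightarrow> real \<Rightarrow> (complex \<Rightarrow> complex) \<Rightarrow> (complex \<Rightarrow> complex) \<Rightarrow> (nat \<Rightarrow> complex) set" where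
  "E_seqs \<alpha> \<beta> u \<phi> = boundary_seqs_infinity
     (\<lambda>z. norm (weighted_deriv \<beta> u z) / (1 - (norm (\<phi> z))\<^sup>2) powr (\<alpha> - 1))"

end

theory Submission
  imports Defs
begin

text \<open>
  Fix \<open>z\<close> and write \<open>a = \<phi> z\<close>, \<open>b = \<psi> z\<close>, \<open>p = u z *
  sharp \<alpha> \<beta> \<phi> z\<close>, \<open>q = v z * sharp \<alpha> \<beta> \<psi> z\<close>,
  \<open>U\<close> and \<open>V\<close> for the weighted derivatives of \<open>u\<close> and \<open>v\<close>
  at \<open>z\<close>, and \<open>\<Phi>\<^sub>c f = (1 - |c|\<^sup>2) powr \<alpha> * f'(c)\<close>. The
  chain rule shows that the weighted derivative at \<open>z\<close> of the image of \<open>f\<close> is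
  \<open>(U f(a) - V f(b)) + (p \<Phi>\<^sub>a f - q \<Phi>\<^sub>b f)\<close>, so that boundedness of the
  operator is a bound by \<open>C \<parallel>f\<parallel>\<close> for this functional, uniform in
  \<open>z\<close> (\<open>bloch_bounded_iff_pointwise\<close>). The value part and the derivative part can be
  handled separately, and the following facts about the Bloch space suffice: \<open>f(a)\<close> is
  \<open>O((1 - |a|\<^sup>2) powr (1 - \<alpha>))\<close> (\<open>bloch_growth\<close>), \<open>\<Phi>\<close>
  is Lipschitz for the pseudo-hyperbolic distance \<open>\<rho>\<close>
  (\<open>weighted_deriv_lipschitz\<close>), and for \<open>\<rho> < 1/9\<close> the increment \<open>f(a) -
  f(b)\<close> is \<open>O(\<rho> (1 - |a|\<^sup>2) powr (1 - \<alpha>))\<close>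
  (\<open>bloch_local_lipschitz\<close>).

  Sufficiency: bounds on \<open>p - q\<close> and \<open>q \<rho>\<close> control the derivative part. For the
  value part, the conditions on sequences are first turned into uniform bounds near the unit circle
  (\<open>boundary_limsup_uniform\<close>). At each such point either both growth quotients are bounded, and
  both terms are bounded on their own, or one of them is large; since the two classes of sequences
  \<open>E_seqs\<close> agree, the conditions along both of them then become available and \<open>U f(a) - V
  f(b) = (U - V) f(a) + V (f(a) - f(b))\<close>, or the same with the two points exchanged, gives the bound.

  Necessity is pointwise in \<open>z\<close>. The functional is tested on products of the peak function
  \<open>g(x) = (1 - |a|\<^sup>2) / (1 - cnj a * x) powr \<alpha>\<close> with polynomials in the disk
  automorphism \<open>s\<close> vanishing at \<open>a\<close>; such products have uniformly bounded norm. With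
  \<open>c = s(b)\<close>, of modulus \<open>\<rho>\<close>, the factors \<open>s (s - c)\<^sup>2\<close>,
  \<open>(s - c)\<^sup>2\<close>, \<open>s\<close> and \<open>1\<close> yield one after the other that
  \<open>p \<rho>\<^sup>2\<close>, \<open>p \<rho>\<close> and \<open>p - q\<close> are bounded and that the
  quotients of \<open>U\<close> and \<open>V\<close> dominate each other up to constants. The standing
  assumptions absorb the terms carrying \<open>U \<rho>\<close> and \<open>V \<rho>\<close>. They also force
  \<open>\<rho>\<close> to be small where a quotient is large, which brings the points into the range of the
  local increment estimate and yields the conditions on upper limits.
\<close>

section \<open>Growth of Bloch functions\<close>

abbreviation defect :: "complex \<Rightarrow> real" where
  "defect z \<equiv> 1 - (norm z)\<^sup>2"

lemma defect_pos: "z \<in> unit_disk \<Longrightarrow> 0 < defect z"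
  by (simp add: power_less_one_iff)

lemma defect_le_two_gap: "norm z < 1 \<Longrightarrow> defect z \<le> 2 * (1 - norm z)"
  using zero_le_power2[of "1 - norm z"] by (simp add: power2_eq_square algebra_simps)

lemma gap_le_defect: "norm z < 1 \<Longrightarrow> 1 - norm z \<le> defect z"
  by (simp add: power2_eq_square mult_left_le)

lemma norm_weighted_deriv:
  "norm (weighted_deriv \<alpha> f z) = defect z powr \<alpha> * norm (deriv f z)"
  by (simp add: weighted_deriv_def norm_mult)

lemma weighted_deriv_le_seminorm:
  assumes "f \<in> bloch_space \<alpha>" "z \<in> unit_disk"
  shows "norm (weighted_deriv \<alpha> f z) \<le> bloch_seminorm \<alpha> f"
  unfolding norm_weighted_deriv bloch_seminorm_def
  using assms by (intro cSUP_upper) (auto simp: bloch_space_def)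

lemma bloch_seminorm_nonneg:
  assumes "f \<in> bloch_space \<alpha>"
  shows "0 \<le> bloch_seminorm \<alpha> f"
  using order_trans[OF norm_ge_zero weighted_deriv_le_seminorm[OF assms, of 0]] by simp

lemma bloch_norm_nonneg: "f \<in> bloch_space \<alpha> \<Longrightarrow> 0 \<le> bloch_norm \<alpha> f"
  by (simp add: bloch_norm_def bloch_seminorm_nonneg)

lemma weighted_deriv_le_bloch_norm:
  assumes "f \<in> bloch_space \<alpha>" "z \<in> unit_disk"
  shows "norm (weighted_deriv \<alpha> f z) \<le> bloch_norm \<alpha> f"
  using weighted_deriv_le_seminorm[OF assms] unfolding bloch_norm_def
  by (smt (verit) norm_ge_zero)

lemma deriv_bound_bloch:
  assumes "f \<in> bloch_space \<alpha>" "z \<in> unit_disk"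
  shows "norm (deriv f z) \<le> bloch_norm \<alpha> f * defect z powr (- \<alpha>)"
  using weighted_deriv_le_bloch_norm[OF assms] defect_pos[OF assms(2)]
  by (simp add: norm_weighted_deriv powr_minus field_simps)

lemma bloch_spaceI:
  assumes "f holomorphic_on unit_disk" "norm (f 0) \<le> A"
    and "\<And>z. z \<in> unit_disk \<Longrightarrow> norm (weighted_deriv \<alpha> f z) \<le> B"
  shows "f \<in> bloch_space \<alpha>" "bloch_norm \<alpha> f \<le> A + B"
proof -
  show "f \<in> bloch_space \<alpha>"
    using assms unfolding bloch_space_def norm_weighted_deriv
    by (auto intro!: bdd_aboveI[of _ B])
  have "bloch_seminorm \<alpha> f \<le> B"
    unfolding bloch_seminorm_def using assms(3)
    by (intro cSUP_least) (auto simp: norm_weighted_deriv)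
  then show "bloch_norm \<alpha> f \<le> A + B"
    using assms(2) by (simp add: bloch_norm_def)
qed

text \<open>
  The last factor comes from replacing \<open>1 - |z|\<close> by \<open>defect z / 2\<close>.
\<close>

definition growth_const :: "real \<Rightarrow> real" where
  "growth_const \<alpha> = (1 + 1 / (\<alpha> - 1)) * (1/2) powr (1 - \<alpha>)"

lemma growth_const_nonneg: "1 < \<alpha> \<Longrightarrow> 0 \<le> growth_const \<alpha>"
  by (simp add: growth_const_def)

text \<open>
  Along the radius to \<open>z\<close> the derivative is at most \<open>N (1 - t |z|) powr (- \<alpha>)\<close>, and for \<open>\<alpha> > 1\<close> the
  integral of this is of order \<open>(1 - |z|) powr (1 - \<alpha>)\<close>. That quantity is at least 1, so it also
  absorbs the value at the origin. Comparing \<open>t \<mapsto> f (t z)\<close> with the primitive of its bound avoids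
  integration.
\<close>

lemma bloch_growth:
  assumes \<alpha>: "1 < \<alpha>" and f: "f \<in> bloch_space \<alpha>" and z: "z \<in> unit_disk"
  shows "norm (f z) \<le> growth_const \<alpha> * defect z powr (1 - \<alpha>) * bloch_norm \<alpha> f"
proof -
  define r where "r = norm z"
  define N where "N = bloch_norm \<alpha> f"
  have r: "0 \<le> r" "r < 1" using z by (auto simp: r_def)
  have holf: "f holomorphic_on unit_disk" using f by (simp add: bloch_space_def)
  have N: "0 \<le> N" using bloch_norm_nonneg[OF f] by (simp add: N_def)
  have tr: "t * r < 1" if "0 \<le> t" "t \<le> 1" for t
    using mult_right_mono[OF that(2) r(1)] r by linarith
  have tz: "of_real t * z \<in> unit_disk" if "0 \<le> t" "t \<le> 1" for t
    using tr[OF that] that by (simp add: norm_mult r_def)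
  have df: "(f has_field_derivative deriv f w) (at w)" if "w \<in> unit_disk" for w
    using holf that by (simp add: holomorphic_derivI)
  have "norm (f (of_real 1 * z) - f (of_real 0 * z))
      \<le> N / (\<alpha> - 1) * (1 - 1 * r) powr (1 - \<alpha>) - N / (\<alpha> - 1) * (1 - 0 * r) powr (1 - \<alpha>)"
  proof (rule differentiable_bound_general[where f = "\<lambda>t. f (of_real t * z)"
        and f' = "\<lambda>t. z * deriv f (of_real t * z)"
        and \<phi>' = "\<lambda>t. N * r * (1 - t * r) powr (- \<alpha>)"])
    show "continuous_on {0..1::real} (\<lambda>t. f (of_real t * z))"
      using tz by (intro continuous_on_compose2[OF holomorphic_on_imp_continuous_on[OF holf]] continuous_intros) auto
    show "continuous_on {0..1::real} (\<lambda>t. N / (\<alpha> - 1) * (1 - t * r) powr (1 - \<alpha>))"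
      using tr by (intro continuous_intros) fastforce+
  next
    fix t :: real assume t: "0 < t" "t < 1"
    have "((\<lambda>t. f (of_real t * z)) has_vector_derivative z * deriv f (of_real t * z)) (at t)"
    proof -
      have "((\<lambda>t. of_real t * z) has_vector_derivative z) (at t)"
        by (rule derivative_eq_intros | simp)+
      from field_vector_diff_chain_at[OF this df[OF tz]] t
      show ?thesis by (simp add: o_def)
    qed
    then show "((\<lambda>t. f (of_real t * z)) has_vector_derivative z * deriv f (of_real t * z)) (at t)" .
    have "((\<lambda>t. N / (\<alpha> - 1) * (1 - t * r) powr (1 - \<alpha>)) has_real_derivative
        N * r * (1 - t * r) powr (- \<alpha>)) (at t)"
    proof (rule DERIV_cong)
      show "((\<lambda>t. N / (\<alpha> - 1) * (1 - t * r) powr (1 - \<alpha>)) has_real_derivative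
          N / (\<alpha> - 1) * ((1 - \<alpha>) * (1 - t * r) powr (- \<alpha>) * (- r))) (at t)"
        using tr[of t] t \<alpha> by (auto intro!: derivative_eq_intros)
      have "N / (\<alpha> - 1) * ((1 - \<alpha>) * X * (- r)) = N * r * X" for X
        using \<alpha> by (simp add: divide_simps) (simp add: algebra_simps)
      then show "N / (\<alpha> - 1) * ((1 - \<alpha>) * (1 - t * r) powr (- \<alpha>) * (- r))
          = N * r * (1 - t * r) powr (- \<alpha>)" .
    qed
    then show "((\<lambda>t. N / (\<alpha> - 1) * (1 - t * r) powr (1 - \<alpha>)) has_vector_derivative
        N * r * (1 - t * r) powr (- \<alpha>)) (at t)"
      by (simp add: has_real_derivative_iff_has_vector_derivative)
    have nt: "norm (of_real t * z) = t * r" using t by (simp add: norm_mult r_def)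
    have "norm (deriv f (of_real t * z)) \<le> N * defect (of_real t * z) powr (- \<alpha>)"
      unfolding N_def by (rule deriv_bound_bloch[OF f tz]) (use t in auto)
    also have "\<dots> \<le> N * (1 - t * r) powr (- \<alpha>)"
    proof (intro mult_left_mono powr_mono2' N)
      show "1 - t * r \<le> defect (of_real t * z)"
        using gap_le_defect[of "of_real t * z"] tr[of t] t unfolding nt by simp
    qed (use \<alpha> tr[of t] t in auto)
    finally show "norm (z * deriv f (of_real t * z)) \<le> N * r * (1 - t * r) powr (- \<alpha>)"
      using mult_left_mono[OF _ r(1)] by (fastforce simp: norm_mult r_def mult_ac)
  qed auto
  then have diff: "norm (f z - f 0) \<le> N / (\<alpha> - 1) * (1 - r) powr (1 - \<alpha>) - N / (\<alpha> - 1)"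
    by simp
  have "(1 - r) powr (1 - \<alpha>) \<le> (defect z / 2) powr (1 - \<alpha>)"
    using defect_le_two_gap[of z] defect_pos[OF z] \<alpha> r by (intro powr_mono2') (auto simp: r_def)
  also have "\<dots> = (1/2) powr (1 - \<alpha>) * defect z powr (1 - \<alpha>)"
    using defect_pos[OF z] powr_mult[of "1/2" "defect z"] by simp
  finally have le: "(1 - r) powr (1 - \<alpha>) \<le> (1/2) powr (1 - \<alpha>) * defect z powr (1 - \<alpha>)" (is "_ \<le> ?P") .
  have one: "1 \<le> (1 - r) powr (1 - \<alpha>)"
    using powr_mono2'[of "1 - \<alpha>" "1 - r" 1] \<alpha> r by simp
  have f0: "norm (f 0) \<le> N"
    using bloch_seminorm_nonneg[OF f] by (simp add: N_def bloch_norm_def)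
  have "norm (f z) \<le> norm (f 0) + norm (f z - f 0)"
    by (metis add.commute diff_add_cancel norm_triangle_ineq)
  also have "\<dots> \<le> N + N / (\<alpha> - 1) * (1 - r) powr (1 - \<alpha>)"
    using f0 diff N \<alpha> by (smt (verit) divide_nonneg_pos)
  also have "\<dots> \<le> N * ?P + N / (\<alpha> - 1) * ?P"
    using N \<alpha> le one mult_left_mono[of 1 ?P N]
    by (intro add_mono mult_left_mono) auto
  also have "\<dots> = (1 + 1 / (\<alpha> - 1)) * ?P * N"
    by (simp add: algebra_simps)
  finally show ?thesis by (simp add: N_def growth_const_def mult.assoc)
qed

section \<open>Lipschitz estimates in the pseudo-hyperbolic distance\<close>

text \<open>
  Euclidean disks whose radius is a small multiple of the defect of their centre are substitutes for
  pseudo-hyperbolic disks: the defect cannot drop there by more than a constant factor, so the derivative of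
  a Bloch function is bounded there in terms of its norm and the centre.
\<close>

lemma defect_near:
  assumes a: "a \<in> unit_disk" and w: "w \<in> ball a (defect a / 4)"
  shows "w \<in> unit_disk" "defect a / 4 \<le> defect w"
proof -
  have "norm w \<le> norm a + norm (w - a)"
    by (metis add.commute diff_add_cancel norm_triangle_ineq)
  moreover have "norm (w - a) < defect a / 4"
    using w by (simp add: dist_norm norm_minus_commute)
  ultimately have gap: "norm w < 1" "defect a / 4 \<le> 1 - norm w"
    using defect_le_two_gap[of a] a by auto
  then show "w \<in> unit_disk" "defect a / 4 \<le> defect w"
    using gap_le_defect[of w] by auto
qed

lemma deriv_bound_near:
  assumes \<alpha>: "1 < \<alpha>" and f: "f \<in> bloch_space \<alpha>"
    and a: "a \<in> unit_disk" and w: "w \<in> ball a (defect a / 4)"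
  shows "norm (deriv f w) \<le> 4 powr \<alpha> * bloch_norm \<alpha> f * defect a powr (- \<alpha>)"
proof -
  have "norm (deriv f w) \<le> bloch_norm \<alpha> f * defect w powr (- \<alpha>)"
    by (rule deriv_bound_bloch[OF f defect_near(1)[OF a w]])
  also have "\<dots> \<le> bloch_norm \<alpha> f * (defect a / 4) powr (- \<alpha>)"
    using defect_near[OF a w] defect_pos[OF a] \<alpha> bloch_norm_nonneg[OF f]
    by (intro mult_left_mono powr_mono2') auto
  also have "(defect a / 4) powr (- \<alpha>) = 4 powr \<alpha> * defect a powr (- \<alpha>)"
    using defect_pos[OF a] by (simp add: powr_divide powr_minus divide_simps)
  finally show ?thesis by (simp add: mult_ac)
qed

lemma diff_near:
  assumes \<alpha>: "1 < \<alpha>" and f: "f \<in> bloch_space \<alpha>"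
    and a: "a \<in> unit_disk" and b: "b \<in> ball a (defect a / 4)"
  shows "norm (f b - f a) \<le> 4 powr \<alpha> * bloch_norm \<alpha> f * defect a powr (- \<alpha>) * norm (b - a)"
proof (rule field_differentiable_bound)
  show "convex (ball a (defect a / 4))" by simp
  show "b \<in> ball a (defect a / 4)" "a \<in> ball a (defect a / 4)"
    using b defect_pos[OF a] by auto
  fix w assume w: "w \<in> ball a (defect a / 4)"
  show "norm (deriv f w) \<le> 4 powr \<alpha> * bloch_norm \<alpha> f * defect a powr (- \<alpha>)"
    by (rule deriv_bound_near[OF \<alpha> f a w])
  show "(f has_field_derivative deriv f w) (at w within ball a (defect a / 4))"
    using f defect_near(1)[OF a w]
    by (auto simp: bloch_space_def intro: holomorphic_derivI has_field_derivative_at_within)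
qed

text \<open>
  Cauchy's inequality on circles of radius \<open>defect a / 8\<close>, which stay in the disk of the first
  derivative bound, controls the second derivative and costs one power of the defect.
\<close>

lemma deriv_diff_near:
  assumes \<alpha>: "1 < \<alpha>" and f: "f \<in> bloch_space \<alpha>"
    and a: "a \<in> unit_disk" and b: "b \<in> ball a (defect a / 8)"
  shows "norm (deriv f b - deriv f a)
    \<le> 8 * 4 powr \<alpha> * bloch_norm \<alpha> f * defect a powr (- \<alpha>) / defect a * norm (b - a)"
proof (rule field_differentiable_bound)
  show "convex (ball a (defect a / 8))" by simp
  show "b \<in> ball a (defect a / 8)" "a \<in> ball a (defect a / 8)"
    using b defect_pos[OF a] by auto
  have holf: "deriv f holomorphic_on unit_disk"
    using f by (auto simp: bloch_space_def intro: holomorphic_deriv)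
  fix w assume w: "w \<in> ball a (defect a / 8)"
  have "ball a (defect a / 8) \<subseteq> ball a (defect a / 4)"
    using defect_pos[OF a] by auto
  then have w': "w \<in> unit_disk" using w defect_near(1)[OF a, of w] by blast
  show "(deriv f has_field_derivative deriv (deriv f) w) (at w within ball a (defect a / 8))"
    using holomorphic_derivI[OF holf _ w'] by (auto intro: has_field_derivative_at_within)
  have sub: "cball w (defect a / 8) \<subseteq> ball a (defect a / 4)"
  proof
    fix x assume "x \<in> cball w (defect a / 8)"
    then show "x \<in> ball a (defect a / 4)"
      using w dist_triangle[of a x w] by (simp add: dist_commute)
  qed
  then have sub': "cball w (defect a / 8) \<subseteq> unit_disk"
    using defect_near(1)[OF a] by blast
  have "norm ((deriv ^^ 1) (deriv f) w)
      \<le> fact 1 * (4 powr \<alpha> * bloch_norm \<alpha> f * defect a powr (- \<alpha>)) / (defect a / 8) ^ 1"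
  proof (rule Cauchy_inequality)
    show "deriv f holomorphic_on ball w (defect a / 8)"
      using holf sub' by (meson ball_subset_cball holomorphic_on_subset order_trans)
    show "continuous_on (cball w (defect a / 8)) (deriv f)"
      using holf sub' by (meson holomorphic_on_imp_continuous_on holomorphic_on_subset)
    show "0 < defect a / 8" using defect_pos[OF a] by simp
    fix x assume "norm (w - x) = defect a / 8"
    then have "x \<in> cball w (defect a / 8)" by (simp add: dist_norm)
    then show "norm (deriv f x) \<le> 4 powr \<alpha> * bloch_norm \<alpha> f * defect a powr (- \<alpha>)"
      using sub by (intro deriv_bound_near[OF \<alpha> f a]) auto
  qed
  then show "norm (deriv (deriv f) w) \<le> 8 * 4 powr \<alpha> * bloch_norm \<alpha> f * defect a powr (- \<alpha>) / defect a"
    by (simp add: field_simps)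
qed

lemma defect_diff:
  assumes "a \<in> unit_disk" "b \<in> unit_disk"
  shows "\<bar>defect b - defect a\<bar> \<le> 2 * norm (b - a)"
proof -
  have "defect b - defect a = (norm a - norm b) * (norm a + norm b)"
    by (simp add: power2_eq_square algebra_simps)
  then have "\<bar>defect b - defect a\<bar> = \<bar>norm a - norm b\<bar> * (norm a + norm b)"
    by (simp add: abs_mult)
  also have "\<dots> \<le> norm (b - a) * 2"
    using assms norm_triangle_ineq3[of a b] by (intro mult_mono) (auto simp: norm_minus_commute)
  finally show ?thesis by simp
qed

text \<open>
  Both sources of variation have the same order: the weight changes by
  \<open>O((defect a) powr (\<alpha> - 1) |b - a|)\<close> while \<open>f'\<close> is \<open>O((defect a) powr (- \<alpha>))\<close>, and the weight
  \<open>(defect a) powr \<alpha>\<close> meets a change of \<open>f'\<close> of order \<open>(defect a) powr (- \<alpha> - 1) |b - a|\<close>.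
\<close>

lemma weighted_deriv_diff_near:
  assumes \<alpha>: "1 < \<alpha>" and f: "f \<in> bloch_space \<alpha>"
    and a: "a \<in> unit_disk" and b: "b \<in> ball a (defect a / 8)"
  shows "norm (weighted_deriv \<alpha> f b - weighted_deriv \<alpha> f a)
    \<le> (\<alpha> * 2 powr \<alpha> + 8) * 4 powr \<alpha> * bloch_norm \<alpha> f * (norm (b - a) / defect a)"
proof -
  define R S N e where "R = defect a" and "S = defect b" and "N = bloch_norm \<alpha> f" and "e = norm (b - a)"
  have R: "0 < R" using defect_pos[OF a] by (simp add: R_def)
  have e: "0 \<le> e" "e < R / 8"
    using b by (auto simp: e_def R_def dist_norm norm_minus_commute)
  have b': "b \<in> ball a (defect a / 4)" using e R by (simp add: e_def R_def dist_norm norm_minus_commute)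
  have bD: "b \<in> unit_disk" by (rule defect_near(1)[OF a b'])
  have S: "0 < S" using defect_pos[OF bD] by (simp add: S_def)
  have SR: "\<bar>S - R\<bar> \<le> 2 * e" using defect_diff[OF a bD] by (simp add: S_def R_def e_def)
  \<comment> \<open>Mean value theorem for \<open>t powr \<alpha>\<close>; both defects lie below \<open>2 R\<close> because \<open>|S - R| \<le> R / 4\<close>.\<close>
  have "norm (S powr \<alpha> - R powr \<alpha>) \<le> \<alpha> * (2 * R) powr (\<alpha> - 1) * norm (S - R)"
  proof (rule field_differentiable_bound)
    show "convex {0<..2 * R}" by simp
    show "S \<in> {0<..2 * R}" "R \<in> {0<..2 * R}" using S R SR e by auto
    fix t assume t: "t \<in> {0<..2 * R}"
    show "((\<lambda>t. t powr \<alpha>) has_field_derivative \<alpha> * t powr (\<alpha> - 1)) (at t within {0<..2 * R})"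
      using t by (auto intro!: derivative_eq_intros)
    show "norm (\<alpha> * t powr (\<alpha> - 1)) \<le> \<alpha> * (2 * R) powr (\<alpha> - 1)"
      using t \<alpha> by (auto simp: abs_mult intro!: powr_mono2)
  qed
  also have "\<dots> \<le> \<alpha> * (2 * R) powr (\<alpha> - 1) * (2 * e)"
    using SR \<alpha> by (intro mult_left_mono) auto
  also have "\<dots> = \<alpha> * 2 powr \<alpha> * R powr \<alpha> * (e / R)"
    using R by (simp add: powr_mult powr_diff field_simps)
  finally have 1: "\<bar>S powr \<alpha> - R powr \<alpha>\<bar> \<le> \<alpha> * 2 powr \<alpha> * R powr \<alpha> * (e / R)" by simp
  have 2: "norm (deriv f b) \<le> 4 powr \<alpha> * N * R powr (- \<alpha>)"
    using deriv_bound_near[OF \<alpha> f a b'] by (simp add: N_def R_def)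
  have 3: "norm (deriv f b - deriv f a) \<le> 8 * 4 powr \<alpha> * N * R powr (- \<alpha>) / R * e"
    using deriv_diff_near[OF \<alpha> f a b] by (simp add: N_def R_def e_def)
  have "weighted_deriv \<alpha> f b - weighted_deriv \<alpha> f a
      = of_real (S powr \<alpha> - R powr \<alpha>) * deriv f b + of_real (R powr \<alpha>) * (deriv f b - deriv f a)"
    by (simp add: weighted_deriv_def S_def R_def algebra_simps)
  also have "norm \<dots> \<le> \<bar>S powr \<alpha> - R powr \<alpha>\<bar> * norm (deriv f b) + R powr \<alpha> * norm (deriv f b - deriv f a)"
    by (rule order_trans[OF norm_triangle_ineq]) (simp add: norm_mult del: of_real_diff)
  also have "\<dots> \<le> (\<alpha> * 2 powr \<alpha> * R powr \<alpha> * (e / R)) * (4 powr \<alpha> * N * R powr (- \<alpha>))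
      + R powr \<alpha> * (8 * 4 powr \<alpha> * N * R powr (- \<alpha>) / R * e)"
    using 1 2 3 \<alpha> e R by (intro add_mono mult_mono mult_left_mono) auto
  also have "\<dots> = (\<alpha> * 2 powr \<alpha> + 8) * 4 powr \<alpha> * N * (e / R)"
    using R by (simp add: powr_minus field_simps)
  finally show ?thesis by (simp add: N_def e_def R_def)
qed

lemma moebius_denominator:
  assumes a: "a \<in> unit_disk" and z: "z \<in> unit_disk"
  shows "0 < Re (1 - cnj a * z)"
    and "defect z / 2 \<le> norm (1 - cnj a * z)" and "defect a / 2 \<le> norm (1 - cnj a * z)"
    and "norm (1 - cnj a * z) \<le> defect a + norm (z - a)"
proof -
  have n: "norm a < 1" "norm z < 1" using a z by auto
  have le: "norm (cnj a * z) \<le> norm a" "norm (cnj a * z) \<le> norm z"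
    using n by (simp_all add: norm_mult mult_left_le mult_left_le_one_le)
  have "Re (cnj a * z) < 1"
    using complex_Re_le_cmod[of "cnj a * z"] le n by linarith
  then show "0 < Re (1 - cnj a * z)" by simp
  have "1 - norm (cnj a * z) \<le> norm (1 - cnj a * z)"
    by (metis norm_one norm_triangle_ineq2)
  then show "defect z / 2 \<le> norm (1 - cnj a * z)" "defect a / 2 \<le> norm (1 - cnj a * z)"
    using le defect_le_two_gap[of a] defect_le_two_gap[of z] n by auto
  have "cnj a * a = of_real ((norm a)\<^sup>2)"
    using complex_norm_square[of a] by (simp add: mult.commute)
  then have "1 - cnj a * z = of_real (defect a) - cnj a * (z - a)"
    by (simp add: algebra_simps)
  also have "norm \<dots> \<le> \<bar>defect a\<bar> + norm a * norm (z - a)"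
    by (rule order_trans[OF norm_triangle_ineq4])
      (simp add: norm_mult del: of_real_diff of_real_power)
  also have "\<dots> \<le> defect a + norm (z - a)"
    using n defect_pos[OF a] by (simp add: mult_left_le_one_le)
  finally show "norm (1 - cnj a * z) \<le> defect a + norm (z - a)" .
qed

lemma pseudo_hyp_dist_commute: "pseudo_hyp_dist a b = pseudo_hyp_dist b a"
proof -
  have "cnj (1 - cnj a * b) = 1 - cnj b * a" by (simp add: mult.commute)
  then have "norm (1 - cnj a * b) = norm (1 - cnj b * a)" by (metis complex_mod_cnj)
  then show ?thesis by (simp add: pseudo_hyp_dist_def norm_divide norm_minus_commute)
qed

lemma pseudo_hyp_dist_nonneg: "0 \<le> pseudo_hyp_dist a b"
  by (simp add: pseudo_hyp_dist_def)

text \<open>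
  If \<open>|b - a| = t * defect a\<close>, then \<open>|1 - cnj a * b| \<le> (1 + t) * defect a\<close> and the pseudo-hyperbolic
  distance is at least \<open>t / (1 + t)\<close>; the value \<open>1/9\<close> corresponds to \<open>t = 1/8\<close>, the radius used in
  the local estimates.
\<close>

lemma pseudo_hyp_dist_near:
  assumes a: "a \<in> unit_disk" and b: "b \<in> unit_disk" and \<rho>: "pseudo_hyp_dist a b < 1/9"
  shows "b \<in> ball a (defect a / 8)" "norm (b - a) / defect a \<le> 9/8 * pseudo_hyp_dist a b"
proof -
  have R: "0 < defect a" by (rule defect_pos[OF a])
  have D: "0 < norm (1 - cnj a * b)" using moebius_denominator(3)[OF a b] R by auto
  then have eq: "norm (b - a) = pseudo_hyp_dist a b * norm (1 - cnj a * b)"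
    unfolding pseudo_hyp_dist_def norm_divide by (simp add: norm_minus_commute)
  also have "\<dots> < 1/9 * norm (1 - cnj a * b)" using \<rho> D by simp
  finally have lt: "norm (b - a) < defect a / 8" using moebius_denominator(4)[OF a b] by argo
  then show "b \<in> ball a (defect a / 8)" by (simp add: dist_norm norm_minus_commute)
  have "norm (b - a) \<le> pseudo_hyp_dist a b * (9/8 * defect a)"
    unfolding eq using lt moebius_denominator(4)[OF a b]
    by (intro mult_left_mono pseudo_hyp_dist_nonneg) (simp add: algebra_simps)
  then show "norm (b - a) / defect a \<le> 9/8 * pseudo_hyp_dist a b"
    using R by (simp add: field_simps)
qed

text \<open>
  The summand \<open>18 = 2 * 9\<close> serves distances of at least \<open>1/9\<close>, where the triangle inequality is enough;
  the other one is the local constant times the factor \<open>9/8\<close> from \<open>pseudo_hyp_dist_near\<close>.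
\<close>

definition lip_const :: "real \<Rightarrow> real" where
  "lip_const \<alpha> = 18 + 9/8 * (\<alpha> * 2 powr \<alpha> + 8) * 4 powr \<alpha>"

lemma lip_const_nonneg: "1 < \<alpha> \<Longrightarrow> 0 \<le> lip_const \<alpha>"
  by (simp add: lip_const_def)

lemma weighted_deriv_lipschitz:
  assumes \<alpha>: "1 < \<alpha>" and f: "f \<in> bloch_space \<alpha>" and a: "a \<in> unit_disk" and b: "b \<in> unit_disk"
  shows "norm (weighted_deriv \<alpha> f b - weighted_deriv \<alpha> f a)
    \<le> lip_const \<alpha> * pseudo_hyp_dist a b * bloch_norm \<alpha> f"
proof -
  define \<rho> N c where "\<rho> = pseudo_hyp_dist a b" and "N = bloch_norm \<alpha> f"
    and "c = (\<alpha> * 2 powr \<alpha> + 8) * 4 powr \<alpha>"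
  have N: "0 \<le> N" using bloch_norm_nonneg[OF f] by (simp add: N_def)
  have \<rho>: "0 \<le> \<rho>" by (simp add: \<rho>_def pseudo_hyp_dist_nonneg)
  have c: "0 \<le> c" using \<alpha> by (simp add: c_def)
  have L: "lip_const \<alpha> = 18 + 9/8 * c" by (simp add: lip_const_def c_def)
  have "norm (weighted_deriv \<alpha> f b - weighted_deriv \<alpha> f a) \<le> (18 + 9/8 * c) * (\<rho> * N)"
  proof (cases "\<rho> < 1/9")
    case True
    then have "norm (weighted_deriv \<alpha> f b - weighted_deriv \<alpha> f a) \<le> c * N * (norm (b - a) / defect a)"
      using weighted_deriv_diff_near[OF \<alpha> f a] pseudo_hyp_dist_near(1)[OF a b]
      by (auto simp: \<rho>_def c_def N_def)
    also have "\<dots> \<le> c * N * (9/8 * \<rho>)"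
      using pseudo_hyp_dist_near(2)[OF a b] True c N by (intro mult_left_mono) (auto simp: \<rho>_def)
    also have "\<dots> = (9/8 * c) * (\<rho> * N)" by simp
    also have "\<dots> \<le> (18 + 9/8 * c) * (\<rho> * N)" using \<rho> N by (intro mult_right_mono) auto
    finally show ?thesis .
  next
    case False
    have "norm (weighted_deriv \<alpha> f b - weighted_deriv \<alpha> f a) \<le> N + N"
      by (rule order_trans[OF norm_triangle_ineq4])
        (unfold N_def, intro add_mono weighted_deriv_le_bloch_norm f a b)
    also have "\<dots> = 18 * (1/9 * N)" by simp
    also have "\<dots> \<le> (18 + 9/8 * c) * (\<rho> * N)"
      using \<rho> N c False by (intro mult_mono) auto
    finally show ?thesis .
  qed
  then show ?thesis by (simp add: L \<rho>_def N_def mult.assoc)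
qed

lemma bloch_local_lipschitz:
  assumes \<alpha>: "1 < \<alpha>" and f: "f \<in> bloch_space \<alpha>" and a: "a \<in> unit_disk" and b: "b \<in> unit_disk"
    and \<rho>: "pseudo_hyp_dist a b < 1/9"
  shows "norm (f b - f a)
    \<le> lip_const \<alpha> * pseudo_hyp_dist a b * defect a powr (1 - \<alpha>) * bloch_norm \<alpha> f"
proof -
  have R: "0 < defect a" by (rule defect_pos[OF a])
  have N: "0 \<le> bloch_norm \<alpha> f" by (rule bloch_norm_nonneg[OF f])
  have "b \<in> ball a (defect a / 4)" using pseudo_hyp_dist_near(1)[OF a b \<rho>] R by simp
  then have "norm (f b - f a) \<le> 4 powr \<alpha> * bloch_norm \<alpha> f * defect a powr (- \<alpha>) * norm (b - a)"
    by (rule diff_near[OF \<alpha> f a])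
  also have "\<dots> = 4 powr \<alpha> * bloch_norm \<alpha> f * defect a powr (1 - \<alpha>) * (norm (b - a) / defect a)"
    using R by (simp add: powr_minus powr_diff field_simps)
  also have "\<dots> \<le> 4 powr \<alpha> * bloch_norm \<alpha> f * defect a powr (1 - \<alpha>) * (9/8 * pseudo_hyp_dist a b)"
    using pseudo_hyp_dist_near(2)[OF a b \<rho>] N by (intro mult_left_mono) auto
  also have "\<dots> = (9/8 * 4 powr \<alpha>) * (pseudo_hyp_dist a b * defect a powr (1 - \<alpha>) * bloch_norm \<alpha> f)"
    by simp
  also have "\<dots> \<le> lip_const \<alpha> * (pseudo_hyp_dist a b * defect a powr (1 - \<alpha>) * bloch_norm \<alpha> f)"
  proof (intro mult_right_mono mult_nonneg_nonneg pseudo_hyp_dist_nonneg N)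
    have "0 \<le> \<alpha> * 2 powr \<alpha>" using \<alpha> by simp
    then have "1 * 4 powr \<alpha> \<le> (\<alpha> * 2 powr \<alpha> + 8) * 4 powr \<alpha>" by (intro mult_right_mono) auto
    then have "9/8 * 4 powr \<alpha> \<le> 9/8 * ((\<alpha> * 2 powr \<alpha> + 8) * 4 powr \<alpha>)" by linarith
    then show "9/8 * 4 powr \<alpha> \<le> lip_const \<alpha>" unfolding lip_const_def by linarith
  qed simp
  finally show ?thesis by (simp add: mult.assoc)
qed

section \<open>Peak functions\<close>

text \<open>
  At its centre this function attains the extremal growth \<open>(defect a) powr (1 - \<alpha>)\<close> of the space,
  while its norm is bounded independently of \<open>a\<close>. The base \<open>1 - cnj a * z\<close> has positive real part, so
  the principal branch of the power is holomorphic on the disk.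
\<close>

definition bloch_peak :: "real \<Rightarrow> complex \<Rightarrow> complex \<Rightarrow> complex" where
  "bloch_peak \<alpha> a z = of_real (defect a) * (1 - cnj a * z) powr (- of_real \<alpha>)"

text \<open>
  The summand 1 bounds the modulus at the origin, the other one the seminorm.
\<close>

definition peak_const :: "real \<Rightarrow> real" where
  "peak_const \<alpha> = 1 + (2 * \<alpha> + 4) * 2 powr \<alpha>"

lemma bloch_peak_has_deriv:
  assumes a: "a \<in> unit_disk" and z: "z \<in> unit_disk"
  shows "(bloch_peak \<alpha> a has_field_derivative
    of_real (defect a) * (of_real \<alpha> * cnj a * (1 - cnj a * z) powr (- of_real \<alpha> - 1))) (at z)"
proof -
  have "1 - cnj a * z \<notin> \<real>\<^sub>\<le>\<^sub>0"
    using moebius_denominator(1)[OF a z] by (auto simp: complex_nonpos_Reals_iff)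
  then have "((\<lambda>z. (1 - cnj a * z) powr (- of_real \<alpha>)) has_field_derivative
      - of_real \<alpha> * (1 - cnj a * z) powr (- of_real \<alpha> - 1) * (- cnj a)) (at z)"
    by (intro DERIV_chain2[OF has_field_derivative_powr]) (auto intro!: derivative_eq_intros)
  from DERIV_cmult[OF this, of "of_real (defect a)"] show ?thesis
    unfolding bloch_peak_def[abs_def] by (simp add: mult_ac)
qed

lemma bloch_peak_holomorphic:
  assumes "a \<in> unit_disk"
  shows "bloch_peak \<alpha> a holomorphic_on unit_disk"
  using bloch_peak_has_deriv[OF assms]
  by (meson field_differentiable_at_within field_differentiable_def holomorphic_onI)

lemma norm_bloch_peak:
  "norm (bloch_peak \<alpha> a z) = \<bar>defect a\<bar> * norm (1 - cnj a * z) powr (- \<alpha>)"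
  by (simp add: bloch_peak_def norm_mult norm_powr_real_powr' del: of_real_diff of_real_power)

lemma bloch_peak_bound:
  assumes \<alpha>: "1 < \<alpha>" and a: "a \<in> unit_disk" and z: "z \<in> unit_disk"
  shows "norm (bloch_peak \<alpha> a z) \<le> 2 powr \<alpha> * defect z powr (1 - \<alpha>)"
    and "norm (deriv (bloch_peak \<alpha> a) z) \<le> 2 * \<alpha> * 2 powr \<alpha> * defect z powr (- \<alpha>)"
proof -
  define D where "D = norm (1 - cnj a * z)"
  have Rz: "0 < defect z" by (rule defect_pos[OF z])
  have Ra: "0 < defect a" by (rule defect_pos[OF a])
  have D: "defect z / 2 \<le> D" "defect a \<le> 2 * D" "0 < D"
    using moebius_denominator(2,3)[OF a z] Rz unfolding D_def by auto
  have R2: "\<bar>defect a\<bar> \<le> 2 * D" using D Ra by simp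
  have "norm (bloch_peak \<alpha> a z) \<le> 2 * D * D powr (- \<alpha>)"
    unfolding norm_bloch_peak D_def[symmetric] using R2 by (intro mult_right_mono) auto
  also have "\<dots> = 2 * D powr (1 - \<alpha>)" using D by (simp add: powr_minus powr_diff field_simps)
  also have "\<dots> \<le> 2 * (defect z / 2) powr (1 - \<alpha>)"
    using D Rz \<alpha> by (intro mult_left_mono powr_mono2') auto
  also have "\<dots> = 2 powr \<alpha> * defect z powr (1 - \<alpha>)"
    using Rz by (simp add: powr_divide powr_diff)
  finally show "norm (bloch_peak \<alpha> a z) \<le> 2 powr \<alpha> * defect z powr (1 - \<alpha>)" .
  have "norm (deriv (bloch_peak \<alpha> a) z) = \<bar>defect a\<bar> * (\<alpha> * norm a * D powr (- \<alpha> - 1))"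
    using DERIV_imp_deriv[OF bloch_peak_has_deriv[OF a z, of \<alpha>]] \<alpha>
    by (simp add: norm_mult norm_powr_real_powr' D_def del: of_real_diff of_real_power)
  also have "\<dots> \<le> 2 * D * (\<alpha> * 1 * D powr (- \<alpha> - 1))"
    using R2 a \<alpha> D by (intro mult_mono) auto
  also have "\<dots> = 2 * \<alpha> * D powr (- \<alpha>)" using D by (simp add: powr_diff)
  also have "\<dots> \<le> 2 * \<alpha> * (defect z / 2) powr (- \<alpha>)"
    using D Rz \<alpha> by (intro mult_left_mono powr_mono2') auto
  also have "\<dots> = 2 * \<alpha> * 2 powr \<alpha> * defect z powr (- \<alpha>)"
    using Rz by (simp add: powr_divide powr_minus divide_simps)
  finally show "norm (deriv (bloch_peak \<alpha> a) z) \<le> 2 * \<alpha> * 2 powr \<alpha> * defect z powr (- \<alpha>)" .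
qed

text \<open>
  The Schwarz-Pick lemma with a larger constant, from Cauchy's inequality on the circle of radius
  \<open>defect z / 4\<close>.
\<close>

lemma deriv_bounded_disk:
  assumes h: "h holomorphic_on unit_disk" "\<And>z. z \<in> unit_disk \<Longrightarrow> norm (h z) \<le> 1"
    and z: "z \<in> unit_disk"
  shows "norm (deriv h z) \<le> 4 / defect z"
proof -
  have R: "0 < defect z" by (rule defect_pos[OF z])
  have "cball z (defect z / 4) \<subseteq> unit_disk"
  proof
    fix x assume "x \<in> cball z (defect z / 4)"
    then have "norm (x - z) \<le> defect z / 4" by (simp add: dist_norm norm_minus_commute)
    moreover have "norm x \<le> norm z + norm (x - z)"
      by (metis add.commute diff_add_cancel norm_triangle_ineq)
    ultimately show "x \<in> unit_disk" using defect_le_two_gap[of z] z R by auto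
  qed
  note sub = this
  have "norm ((deriv ^^ 1) h z) \<le> fact 1 * 1 / (defect z / 4) ^ 1"
  proof (rule Cauchy_inequality)
    show "h holomorphic_on ball z (defect z / 4)"
      using h sub by (meson ball_subset_cball holomorphic_on_subset order_trans)
    show "continuous_on (cball z (defect z / 4)) h"
      using h sub by (meson holomorphic_on_imp_continuous_on holomorphic_on_subset)
    show "0 < defect z / 4" using R by simp
    fix x assume "norm (z - x) = defect z / 4"
    then have "x \<in> cball z (defect z / 4)" by (simp add: dist_norm)
    then show "norm (h x) \<le> 1" using sub h by blast
  qed
  then show ?thesis by simp
qed

text \<open>
  The peak function is itself \<open>O((defect z) powr (1 - \<alpha>))\<close>, thanks to \<open>\<alpha> > 1\<close>, and the derivative of a
  bounded function is \<open>O(1 / defect z)\<close>. Hence bounded factors may be inserted freely, which allows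
  the values and derivatives at two points to be prescribed.
\<close>

lemma peak_times_bounded:
  assumes \<alpha>: "1 < \<alpha>" and a: "a \<in> unit_disk"
    and h: "h holomorphic_on unit_disk" "\<And>z. z \<in> unit_disk \<Longrightarrow> norm (h z) \<le> 1"
  shows "(\<lambda>z. bloch_peak \<alpha> a z * h z) \<in> bloch_space \<alpha>"
    and "bloch_norm \<alpha> (\<lambda>z. bloch_peak \<alpha> a z * h z) \<le> peak_const \<alpha>"
proof -
  have hol: "(\<lambda>z. bloch_peak \<alpha> a z * h z) holomorphic_on unit_disk"
    by (intro holomorphic_intros bloch_peak_holomorphic a h)
  have at0: "norm (bloch_peak \<alpha> a 0 * h 0) \<le> 1"
  proof -
    have "0 \<le> defect a" "defect a \<le> 1" using defect_pos[OF a] by auto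
    then have "norm (bloch_peak \<alpha> a 0) \<le> 1" unfolding norm_bloch_peak by simp
    then show ?thesis using h(2)[of 0] by (simp add: norm_mult mult_le_one)
  qed
  have der: "norm (weighted_deriv \<alpha> (\<lambda>z. bloch_peak \<alpha> a z * h z) z) \<le> (2 * \<alpha> + 4) * 2 powr \<alpha>"
    if z: "z \<in> unit_disk" for z
  proof -
    let ?g = "bloch_peak \<alpha> a"
    have R: "0 < defect z" by (rule defect_pos[OF z])
    have "?g field_differentiable at z" "h field_differentiable at z"
      using bloch_peak_has_deriv[OF a z] holomorphic_derivI[OF h(1) open_ball z]
      unfolding field_differentiable_def by blast+
    then have "deriv (\<lambda>z. ?g z * h z) z = ?g z * deriv h z + deriv ?g z * h z"
      by (rule deriv_mult)
    also have "norm \<dots> \<le> norm (?g z) * norm (deriv h z) + norm (deriv ?g z) * norm (h z)"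
      by (rule order_trans[OF norm_triangle_ineq]) (simp add: norm_mult)
    also have "\<dots> \<le> (2 powr \<alpha> * defect z powr (1 - \<alpha>)) * (4 / defect z)
        + (2 * \<alpha> * 2 powr \<alpha> * defect z powr (- \<alpha>)) * 1"
      using bloch_peak_bound[OF \<alpha> a z] deriv_bounded_disk[OF h z] h(2)[OF z] \<alpha> R
      by (intro add_mono mult_mono) auto
    also have "\<dots> = (2 * \<alpha> + 4) * 2 powr \<alpha> * defect z powr (- \<alpha>)"
      using R by (simp add: powr_minus powr_diff field_simps)
    finally have "norm (deriv (\<lambda>z. ?g z * h z) z) \<le> (2 * \<alpha> + 4) * 2 powr \<alpha> * defect z powr (- \<alpha>)" .
    then have "defect z powr \<alpha> * norm (deriv (\<lambda>z. ?g z * h z) z)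
        \<le> defect z powr \<alpha> * ((2 * \<alpha> + 4) * 2 powr \<alpha> * defect z powr (- \<alpha>))"
      by (intro mult_left_mono) auto
    also have "\<dots> = (2 * \<alpha> + 4) * 2 powr \<alpha>" using R by (simp add: powr_minus)
    finally show ?thesis unfolding norm_weighted_deriv .
  qed
  show "(\<lambda>z. bloch_peak \<alpha> a z * h z) \<in> bloch_space \<alpha>"
    by (rule bloch_spaceI(1)[OF hol at0 der])
  show "bloch_norm \<alpha> (\<lambda>z. bloch_peak \<alpha> a z * h z) \<le> peak_const \<alpha>"
    unfolding peak_const_def by (rule bloch_spaceI(2)[OF hol at0 der])
qed

lemma bloch_peak_in_space:
  assumes "1 < \<alpha>" "a \<in> unit_disk"
  shows "bloch_peak \<alpha> a \<in> bloch_space \<alpha>" "bloch_norm \<alpha> (bloch_peak \<alpha> a) \<le> peak_const \<alpha>"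
  using peak_times_bounded[OF assms, of "\<lambda>z. 1"] by simp_all

lemma one_minus_cnj_self: "1 - cnj a * a = of_real (defect a)"
  using complex_norm_square[of a] by (simp add: mult.commute)

lemma peak_times_at_centre:
  assumes a: "a \<in> unit_disk" and h: "(h has_field_derivative h') (at a)"
  shows "bloch_peak \<alpha> a a * h a = of_real (defect a powr (1 - \<alpha>)) * h a"
    and "weighted_deriv \<alpha> (\<lambda>z. bloch_peak \<alpha> a z * h z) a
      = of_real \<alpha> * cnj a * h a + of_real (defect a) * h'"
proof -
  define R where "R = defect a"
  have R: "0 < R" using defect_pos[OF a] by (simp add: R_def)
  have pw: "(1 - cnj a * a) powr (of_real s) = of_real (R powr s)" for s
    unfolding one_minus_cnj_self R_def[symmetric] using R by (simp add: powr_of_real)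
  have pw1: "(1 - cnj a * a) powr (- of_real \<alpha>) = of_real (R powr (- \<alpha>))"
    using pw[of "- \<alpha>"] by simp
  have pw2: "(1 - cnj a * a) powr (- of_real \<alpha> - 1) = of_real (R powr (- \<alpha> - 1))"
    using pw[of "- \<alpha> - 1"] by simp
  have ga: "bloch_peak \<alpha> a a = of_real (R powr (1 - \<alpha>))"
    unfolding bloch_peak_def pw1 R_def[symmetric] of_real_mult[symmetric]
    using R by (simp add: powr_minus powr_diff divide_inverse del: of_real_mult)
  then show "bloch_peak \<alpha> a a * h a = of_real (defect a powr (1 - \<alpha>)) * h a"
    by (simp add: R_def)
  have "deriv (\<lambda>z. bloch_peak \<alpha> a z * h z) a
      = of_real R * (of_real \<alpha> * cnj a * of_real (R powr (- \<alpha> - 1))) * h a + h' * of_real (R powr (1 - \<alpha>))"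
    using DERIV_imp_deriv[OF DERIV_mult[OF bloch_peak_has_deriv[OF a a, of \<alpha>] h]]
    unfolding pw2 ga R_def[symmetric] by simp
  moreover have "of_real (R powr \<alpha>) * (of_real R * of_real (R powr (- \<alpha> - 1))) = (1 :: complex)"
    unfolding of_real_mult[symmetric] using R by (simp add: powr_minus powr_diff del: of_real_mult)
  moreover have "of_real (R powr \<alpha>) * of_real (R powr (1 - \<alpha>)) = (of_real R :: complex)"
    unfolding of_real_mult[symmetric] using R by (simp add: powr_diff del: of_real_mult)
  ultimately show "weighted_deriv \<alpha> (\<lambda>z. bloch_peak \<alpha> a z * h z) a
      = of_real \<alpha> * cnj a * h a + of_real (defect a) * h'"
    unfolding weighted_deriv_def R_def[symmetric] by algebra
qed

lemma peak_times_double_zero: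
  assumes a: "a \<in> unit_disk" and b: "b \<in> unit_disk"
    and h: "(h has_field_derivative 0) (at b)" "h b = 0"
  shows "weighted_deriv \<beta> (\<lambda>z. bloch_peak \<alpha> a z * h z) b = 0"
  using DERIV_imp_deriv[OF DERIV_mult[OF bloch_peak_has_deriv[OF a b, of \<alpha>] h(1)]] h(2)
  by (simp add: weighted_deriv_def)

abbreviation disk_moebius :: "complex \<Rightarrow> complex \<Rightarrow> complex" where
  "disk_moebius \<equiv> Moebius_function 0"

lemma disk_moebius_facts:
  assumes a: "a \<in> unit_disk"
  shows "disk_moebius a holomorphic_on unit_disk"
    and "\<And>z. z \<in> unit_disk \<Longrightarrow> norm (disk_moebius a z) \<le> 1"
    and "(disk_moebius a has_field_derivative 1 / of_real (defect a)) (at a)"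
    and "disk_moebius a a = 0"
    and "norm (disk_moebius a b) = pseudo_hyp_dist a b"
proof -
  show "disk_moebius a holomorphic_on unit_disk"
    using a by (simp add: Moebius_function_holomorphic)
  show "norm (disk_moebius a z) \<le> 1" if "z \<in> unit_disk" for z
    using Moebius_function_norm_lt_1[of a z 0] a that by (simp add: less_imp_le)
  show "disk_moebius a a = 0" by (rule Moebius_function_eq_zero)
  show "norm (disk_moebius a b) = pseudo_hyp_dist a b"
    by (simp add: Moebius_function_simple pseudo_hyp_dist_def norm_divide norm_minus_commute)
  have nz: "1 - cnj a * a \<noteq> 0" using moebius_denominator(1)[OF a a] by force
  have "(disk_moebius a has_field_derivative 1 / (1 - cnj a * a)) (at a)"
    unfolding Moebius_function_simple[abs_def]
  proof (rule DERIV_cong)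
    show "((\<lambda>z. (z - a) / (1 - cnj a * z)) has_field_derivative
        (1 * (1 - cnj a * a) - (a - a) * (- cnj a)) / ((1 - cnj a * a) * (1 - cnj a * a))) (at a)"
      using nz by (auto intro!: derivative_eq_intros)
  qed (use nz in simp)
  then show "(disk_moebius a has_field_derivative 1 / of_real (defect a)) (at a)"
    by (simp only: one_minus_cnj_self)
qed

section \<open>Testing the functional at a single point\<close>

text \<open>
  The situation at one point \<open>z\<close> for a bounded operator, with \<open>a = \<phi> z\<close> and \<open>b = \<psi> z\<close>. The constants
  \<open>C\<close> and \<open>M\<close> do not depend on \<open>z\<close>, and every bound derived here is expressed through \<open>\<alpha>\<close>, \<open>C\<close>
  and \<open>M\<close> alone; this is what makes the conclusions uniform.
\<close>

locale bloch_functional =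
  fixes \<alpha> C M :: real and a b U V p q :: complex
  assumes \<alpha>: "1 < \<alpha>" and a: "a \<in> unit_disk" and b: "b \<in> unit_disk"
    and bounded: "\<And>f. f \<in> bloch_space \<alpha> \<Longrightarrow>
      norm (U * f a - V * f b + p * weighted_deriv \<alpha> f a - q * weighted_deriv \<alpha> f b) \<le> C * bloch_norm \<alpha> f"
    and M_a: "norm U * pseudo_hyp_dist a b / defect a powr (\<alpha> - 1) \<le> M"
    and M_b: "norm V * pseudo_hyp_dist a b / defect b powr (\<alpha> - 1) \<le> M"
    and C: "0 \<le> C"
begin

abbreviation \<rho> :: real where "\<rho> \<equiv> pseudo_hyp_dist a b"

text \<open>
  Exchanging the two maps changes the functional only by a sign, so that each estimate for \<open>(U, p)\<close>
  also holds for \<open>(V, q)\<close>.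
\<close>

lemma swap: "bloch_functional \<alpha> C M b a V U q p"
proof
  fix f assume "f \<in> bloch_space \<alpha>"
  from bounded[OF this]
  show "norm (V * f b - U * f a + q * weighted_deriv \<alpha> f b - p * weighted_deriv \<alpha> f a) \<le> C * bloch_norm \<alpha> f"
    by (subst norm_minus_cancel[symmetric]) (simp add: algebra_simps)
qed (use \<alpha> a b M_a M_b C in \<open>simp_all add: pseudo_hyp_dist_commute[of b a]\<close>)

lemma rho_nonneg: "0 \<le> \<rho>" and rho_le_1: "\<rho> \<le> 1"
  using disk_moebius_facts(2,5)[OF a] b by (metis norm_ge_zero)+

lemma M_nonneg: "0 \<le> M"
  by (rule order_trans[OF _ M_a]) (simp add: rho_nonneg)

lemma M_a': "norm U * \<rho> * defect a powr (1 - \<alpha>) \<le> M"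
  using M_a powr_minus[of "defect a" "\<alpha> - 1"] by (simp add: divide_inverse)

lemma M_b': "norm V * \<rho> * defect b powr (1 - \<alpha>) \<le> M"
  using M_b powr_minus[of "defect b" "\<alpha> - 1"] by (simp add: divide_inverse)

lemma peak_bounded:
  assumes h: "h holomorphic_on unit_disk" "\<And>z. z \<in> unit_disk \<Longrightarrow> norm (h z) \<le> 1"
    and h': "(h has_field_derivative h') (at a)"
  shows "norm (U * (of_real (defect a powr (1 - \<alpha>)) * h a) - V * (bloch_peak \<alpha> a b * h b)
      + p * (of_real \<alpha> * cnj a * h a + of_real (defect a) * h')
      - q * weighted_deriv \<alpha> (\<lambda>z. bloch_peak \<alpha> a z * h z) b) \<le> C * peak_const \<alpha>"
proof -
  note pk = peak_times_bounded[OF \<alpha> a h]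
  have "C * bloch_norm \<alpha> (\<lambda>z. bloch_peak \<alpha> a z * h z) \<le> C * peak_const \<alpha>"
    using pk(2) C by (rule mult_left_mono)
  with bounded[OF pk(1)] show ?thesis
    unfolding peak_times_at_centre[OF a h'] by linarith
qed

text \<open>
  Test with the factor \<open>s (s - c)\<^sup>2 / 4\<close>, where \<open>s\<close> is the disk automorphism vanishing at \<open>a\<close> and
  \<open>c = s b\<close>. The zero at \<open>a\<close> removes \<open>U\<close>, the double zero at \<open>b\<close> removes \<open>V\<close> and \<open>q\<close>, and
  \<open>p c\<^sup>2 / 4\<close> remains.
\<close>

lemma p_rho_squared: "norm p * \<rho>\<^sup>2 \<le> 4 * C * peak_const \<alpha>"
proof -
  define c where "c = disk_moebius a b"
  define h where "h = (\<lambda>z. disk_moebius a z * (disk_moebius a z - c)\<^sup>2 / 4)"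
  note m = disk_moebius_facts[OF a]
  have nc: "norm c = \<rho>" by (simp add: c_def m(5))
  have h1: "h holomorphic_on unit_disk"
    unfolding h_def by (intro holomorphic_intros m(1)) auto
  have h2: "norm (h z) \<le> 1" if z: "z \<in> unit_disk" for z
  proof -
    have "norm (disk_moebius a z - c) \<le> 2"
      using norm_triangle_ineq4[of "disk_moebius a z" c] m(2)[OF z] nc rho_le_1 by linarith
    then have "(norm (disk_moebius a z - c))\<^sup>2 \<le> 2\<^sup>2" by (intro power_mono) auto
    then have "norm (disk_moebius a z) * (norm (disk_moebius a z - c))\<^sup>2 \<le> 1 * 2\<^sup>2"
      using m(2)[OF z] by (intro mult_mono) auto
    then show ?thesis by (simp add: h_def norm_mult norm_divide norm_power)
  qed
  define d :: complex where "d = 1 / of_real (defect a)"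
  have unit: "of_real (defect a) * d = 1"
    using defect_pos[OF a] by (simp add: d_def del: of_real_diff)
  have h3: "(h has_field_derivative c\<^sup>2 / 4 * d) (at a)"
    unfolding h_def by (rule derivative_eq_intros m(3)[folded d_def] refl | simp add: m(4))+
  obtain m' where m': "(disk_moebius a has_field_derivative m') (at b)"
    using holomorphic_derivI[OF m(1) _ b] by blast
  have h4: "(h has_field_derivative 0) (at b)"
    unfolding h_def by (rule derivative_eq_intros m' refl | simp add: c_def)+
  have "h a = 0" "h b = 0" by (simp_all add: h_def m(4) c_def)
  then have "norm (p * (of_real (defect a) * (c\<^sup>2 / 4 * d))) \<le> C * peak_const \<alpha>"
    using peak_bounded[OF h1 h2 h3] peak_times_double_zero[OF a b h4] by simp
  also have "p * (of_real (defect a) * (c\<^sup>2 / 4 * d)) = p * c\<^sup>2 / 4 * (of_real (defect a) * d)"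
    by (simp only: mult_ac times_divide_eq_left times_divide_eq_right)
  also have "\<dots> = p * c\<^sup>2 / 4" unfolding unit by simp
  finally show ?thesis by (simp add: norm_mult norm_divide norm_power nc)
qed

definition sharp_rho_bound :: real where "sharp_rho_bound = 2 * C * peak_const \<alpha> + M / 2 + 2 * \<alpha> * C * peak_const \<alpha>"

text \<open>
  Without the factor \<open>s\<close>, the factor \<open>(s - c)\<^sup>2 / 4\<close> has a derivative of first order in \<open>c\<close> at \<open>a\<close>,
  which improves \<open>\<rho>\<^sup>2\<close> to \<open>\<rho>\<close>. Two new terms of order \<open>c\<^sup>2\<close> appear: the one with \<open>U\<close> is controlled by
  the assumption on \<open>U\<close>, the one with \<open>p\<close> by \<open>p_rho_squared\<close>.
\<close>

lemma p_rho: "norm p * \<rho> \<le> sharp_rho_bound"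
proof -
  define c where "c = disk_moebius a b"
  define h where "h = (\<lambda>z. (disk_moebius a z - c)\<^sup>2 / 4)"
  note m = disk_moebius_facts[OF a]
  have nc: "norm c = \<rho>" by (simp add: c_def m(5))
  have h1: "h holomorphic_on unit_disk"
    unfolding h_def by (intro holomorphic_intros m(1)) auto
  have h2: "norm (h z) \<le> 1" if z: "z \<in> unit_disk" for z
  proof -
    have "norm (disk_moebius a z - c) \<le> 2"
      using norm_triangle_ineq4[of "disk_moebius a z" c] m(2)[OF z] nc rho_le_1 by linarith
    then have "(norm (disk_moebius a z - c))\<^sup>2 \<le> 2\<^sup>2" by (intro power_mono) auto
    then show ?thesis by (simp add: h_def norm_divide norm_power)
  qed
  define d :: complex where "d = 1 / of_real (defect a)"
  have unit: "of_real (defect a) * d = 1"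
    using defect_pos[OF a] by (simp add: d_def del: of_real_diff)
  have h3: "(h has_field_derivative - c / 2 * d) (at a)"
    unfolding h_def by (rule derivative_eq_intros m(3)[folded d_def] refl | simp add: m(4))+
  obtain m' where m': "(disk_moebius a has_field_derivative m') (at b)"
    using holomorphic_derivI[OF m(1) _ b] by blast
  have h4: "(h has_field_derivative 0) (at b)"
    unfolding h_def by (rule derivative_eq_intros m' refl | simp add: c_def)+
  have ha: "h a = c\<^sup>2 / 4" and hb: "h b = 0" by (simp_all add: h_def m(4) c_def)
  define A where "A = U * (of_real (defect a powr (1 - \<alpha>)) * (c\<^sup>2 / 4))"
  define B where "B = p * (of_real \<alpha> * cnj a * (c\<^sup>2 / 4))"
  have "of_real (defect a) * (- c / 2 * d) = - c / 2 * (of_real (defect a) * d)"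
    by (simp only: mult_ac times_divide_eq_left times_divide_eq_right)
  then have slope: "of_real (defect a) * (- c / 2 * d) = - c / 2" unfolding unit by simp
  have "norm (A + p * (of_real \<alpha> * cnj a * (c\<^sup>2 / 4) + - c / 2)) \<le> C * peak_const \<alpha>"
    using peak_bounded[OF h1 h2 h3] unfolding peak_times_double_zero[OF a b h4 hb] ha hb slope
    by (simp add: A_def)
  then have 0: "norm (A + B - p * (c / 2)) \<le> C * peak_const \<alpha>"
    by (simp add: B_def algebra_simps)
  have "norm A = norm U * \<rho> * defect a powr (1 - \<alpha>) * \<rho> / 4"
    by (simp add: A_def norm_mult norm_divide norm_power nc power2_eq_square)
  also have "\<dots> \<le> M * 1 / 4"
    using M_a' rho_nonneg rho_le_1 M_nonneg by (intro divide_right_mono mult_mono) auto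
  finally have 1: "norm A \<le> M / 4" by simp
  have "norm B = \<alpha> * norm a * (norm p * \<rho>\<^sup>2) / 4"
    using \<alpha> by (simp add: B_def norm_mult norm_divide norm_power nc)
  also have "\<dots> \<le> \<alpha> * 1 * (4 * C * peak_const \<alpha>) / 4"
    using a p_rho_squared \<alpha>
      mult_mono[of "\<alpha> * norm a" "\<alpha> * 1" "norm p * \<rho>\<^sup>2" "4 * C * peak_const \<alpha>"]
    by (intro divide_right_mono) auto
  finally have 2: "norm B \<le> \<alpha> * C * peak_const \<alpha>" by simp
  have "norm (p * (c / 2)) = norm (A + B - (A + B - p * (c / 2)))" by simp
  also have "\<dots> \<le> norm A + norm B + norm (A + B - p * (c / 2))"
    by (meson norm_triangle_ineq norm_triangle_ineq4 order_trans add_right_mono)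
  also have "\<dots> \<le> M / 4 + \<alpha> * C * peak_const \<alpha> + C * peak_const \<alpha>"
    using 0 1 2 by linarith
  finally show ?thesis by (simp add: norm_mult norm_divide nc sharp_rho_bound_def)
qed

lemma q_rho: "norm q * \<rho> \<le> sharp_rho_bound"
proof -
  interpret swapped: bloch_functional \<alpha> C M b a V U q p by (rule swap)
  show ?thesis using swapped.p_rho by (simp add: pseudo_hyp_dist_commute[of b a])
qed

lemma sharp_rho_bound_nonneg: "0 \<le> sharp_rho_bound"
  by (rule order_trans[OF _ p_rho]) (simp add: rho_nonneg)

definition sharp_diff_bound :: real where "sharp_diff_bound = C * peak_const \<alpha> + 2 powr \<alpha> * M + sharp_rho_bound * lip_const \<alpha> * peak_const \<alpha>"

text \<open>
  Test with the factor \<open>s\<close>. The value at \<open>a\<close> is 0 and the weighted derivative there is 1; passing to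
  \<open>b\<close> produces errors of order \<open>\<rho>\<close>, which the bounds on \<open>V \<rho>\<close> and \<open>q \<rho>\<close> absorb.
\<close>

lemma p_minus_q: "norm (p - q) \<le> sharp_diff_bound"
proof -
  note m = disk_moebius_facts[OF a]
  define F where "F = (\<lambda>z. bloch_peak \<alpha> a z * disk_moebius a z)"
  define W where "W = weighted_deriv \<alpha> F b"
  have F: "F \<in> bloch_space \<alpha>" "bloch_norm \<alpha> F \<le> peak_const \<alpha>"
    unfolding F_def using peak_times_bounded[OF \<alpha> a m(1,2)] by blast+
  have unit: "of_real (defect a) * (1 / of_real (defect a)) = (1 :: complex)"
    using defect_pos[OF a] by (simp add: field_simps del: of_real_diff)
  have Wa: "weighted_deriv \<alpha> F a = 1"
    unfolding F_def peak_times_at_centre(2)[OF a m(3)] unit by (simp add: m(4))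
  have 0: "norm (- (V * F b) + p - q * W) \<le> C * peak_const \<alpha>"
    using peak_bounded[OF m(1,2,3)] unfolding unit
    by (simp add: m(4) W_def F_def)
  have "norm (V * F b) = norm V * \<rho> * norm (bloch_peak \<alpha> a b)"
    by (simp add: F_def norm_mult m(5))
  also have "\<dots> \<le> norm V * \<rho> * (2 powr \<alpha> * defect b powr (1 - \<alpha>))"
    using bloch_peak_bound(1)[OF \<alpha> a b] rho_nonneg by (intro mult_left_mono) auto
  also have "\<dots> = 2 powr \<alpha> * (norm V * \<rho> * defect b powr (1 - \<alpha>))" by simp
  also have "\<dots> \<le> 2 powr \<alpha> * M" using M_b' by (intro mult_left_mono) auto
  finally have 1: "norm (V * F b) \<le> 2 powr \<alpha> * M" .
  have "norm (q * (W - 1)) \<le> norm q * (lip_const \<alpha> * \<rho> * bloch_norm \<alpha> F)"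
    using weighted_deriv_lipschitz[OF \<alpha> F(1) a b] by (simp add: norm_mult W_def Wa mult_left_mono)
  also have "\<dots> = (norm q * \<rho>) * lip_const \<alpha> * bloch_norm \<alpha> F" by simp
  also have "\<dots> \<le> sharp_rho_bound * lip_const \<alpha> * peak_const \<alpha>"
    using q_rho F lip_const_nonneg[OF \<alpha>] sharp_rho_bound_nonneg rho_nonneg bloch_norm_nonneg[OF F(1)]
    by (intro mult_mono) auto
  finally have 2: "norm (q * (W - 1)) \<le> sharp_rho_bound * lip_const \<alpha> * peak_const \<alpha>" .
  have "p - q = (- (V * F b) + p - q * W) + V * F b + q * (W - 1)"
    by (simp add: algebra_simps)
  also have "norm \<dots> \<le> norm (- (V * F b) + p - q * W) + norm (V * F b) + norm (q * (W - 1))"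
    by (meson norm_triangle_ineq order_trans add_right_mono)
  finally show ?thesis using 0 1 2 by (simp add: sharp_diff_bound_def)
qed

definition value_bound :: real where "value_bound = C + sharp_diff_bound + sharp_rho_bound * lip_const \<alpha>"

lemma value_bound_nonneg: "0 \<le> value_bound"
  using C sharp_rho_bound_nonneg lip_const_nonneg[OF \<alpha>] order_trans[OF norm_ge_zero p_minus_q]
  by (simp add: value_bound_def)

end

text \<open>
  Stated outside the locale, from bounds on the coefficients alone, because the converse direction
  relies on it as well.
\<close>

lemma derivative_part_bound:
  assumes \<alpha>: "1 < \<alpha>" and a: "a \<in> unit_disk" and b: "b \<in> unit_disk"
    and pq: "norm (p - q) \<le> Q" and q: "norm q * pseudo_hyp_dist a b \<le> P"
    and f: "f \<in> bloch_space \<alpha>"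
  shows "norm (p * weighted_deriv \<alpha> f a - q * weighted_deriv \<alpha> f b)
    \<le> (Q + P * lip_const \<alpha>) * bloch_norm \<alpha> f"
proof -
  let ?N = "bloch_norm \<alpha> f"
  have N: "0 \<le> ?N" by (rule bloch_norm_nonneg[OF f])
  have "norm ((p - q) * weighted_deriv \<alpha> f a) \<le> Q * ?N"
    unfolding norm_mult using pq weighted_deriv_le_bloch_norm[OF f a] order_trans[OF norm_ge_zero pq]
    by (intro mult_mono) auto
  moreover have "norm (q * (weighted_deriv \<alpha> f b - weighted_deriv \<alpha> f a)) \<le> P * lip_const \<alpha> * ?N"
  proof -
    have "norm (q * (weighted_deriv \<alpha> f b - weighted_deriv \<alpha> f a))
        \<le> norm q * (lip_const \<alpha> * pseudo_hyp_dist a b * ?N)"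
      unfolding norm_mult using weighted_deriv_lipschitz[OF \<alpha> f a b] by (rule mult_left_mono) simp
    also have "\<dots> = (norm q * pseudo_hyp_dist a b) * (lip_const \<alpha> * ?N)" by simp
    also have "\<dots> \<le> P * (lip_const \<alpha> * ?N)"
      using q N lip_const_nonneg[OF \<alpha>] by (intro mult_right_mono) auto
    finally show ?thesis by (simp add: mult.assoc)
  qed
  moreover have "p * weighted_deriv \<alpha> f a - q * weighted_deriv \<alpha> f b
      = (p - q) * weighted_deriv \<alpha> f a - q * (weighted_deriv \<alpha> f b - weighted_deriv \<alpha> f a)"
    by (simp add: algebra_simps)
  ultimately show ?thesis
    using norm_triangle_ineq4[of "(p - q) * weighted_deriv \<alpha> f a"
        "q * (weighted_deriv \<alpha> f b - weighted_deriv \<alpha> f a)"]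
    by (simp add: algebra_simps)
qed

context bloch_functional
begin

lemma value_part_bound:
  assumes f: "f \<in> bloch_space \<alpha>"
  shows "norm (U * f a - V * f b) \<le> value_bound * bloch_norm \<alpha> f"
proof -
  have "U * f a - V * f b = (U * f a - V * f b + p * weighted_deriv \<alpha> f a - q * weighted_deriv \<alpha> f b)
      - (p * weighted_deriv \<alpha> f a - q * weighted_deriv \<alpha> f b)" by simp
  also have "norm \<dots> \<le> C * bloch_norm \<alpha> f + (sharp_diff_bound + sharp_rho_bound * lip_const \<alpha>) * bloch_norm \<alpha> f"
    by (intro order_trans[OF norm_triangle_ineq4] add_mono bounded f
        derivative_part_bound[OF \<alpha> a b p_minus_q q_rho])
  finally show ?thesis by (simp add: value_bound_def algebra_simps)
qed

lemma peak_value_bounded: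
  "norm (U * of_real (defect a powr (1 - \<alpha>)) - V * bloch_peak \<alpha> a b) \<le> value_bound * peak_const \<alpha>"
proof -
  note pk = bloch_peak_in_space[OF \<alpha> a]
  have "value_bound * bloch_norm \<alpha> (bloch_peak \<alpha> a) \<le> value_bound * peak_const \<alpha>"
    using pk(2) value_bound_nonneg by (rule mult_left_mono)
  then show ?thesis
    using value_part_bound[OF pk(1)] peak_times_at_centre(1)[OF a DERIV_const[of 1], of \<alpha>] by simp
qed

text \<open>
  The peak function centred at \<open>a\<close> turns the quotient of \<open>U\<close> into a value of the functional; at \<open>b\<close>
  it cannot exceed the general growth rate.
\<close>

lemma U_dominated:
  "norm U / defect a powr (\<alpha> - 1) \<le> value_bound * peak_const \<alpha> + 2 powr \<alpha> * (norm V / defect b powr (\<alpha> - 1))"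
proof -
  have "norm U * defect a powr (1 - \<alpha>) = norm (U * of_real (defect a powr (1 - \<alpha>)))"
    by (simp add: norm_mult)
  also have "\<dots> \<le> norm (U * of_real (defect a powr (1 - \<alpha>)) - V * bloch_peak \<alpha> a b) + norm (V * bloch_peak \<alpha> a b)"
    by (metis diff_add_cancel norm_triangle_ineq)
  also have "\<dots> \<le> value_bound * peak_const \<alpha> + norm V * (2 powr \<alpha> * defect b powr (1 - \<alpha>))"
    using bloch_peak_bound(1)[OF \<alpha> a b]
    by (intro add_mono peak_value_bounded) (simp add: norm_mult mult_left_mono)
  finally show ?thesis
    using powr_minus[of "defect a" "\<alpha> - 1"] powr_minus[of "defect b" "\<alpha> - 1"]
    by (simp add: divide_inverse mult_ac)
qed

text \<open>
  For nearby points the increment of \<open>f\<close> is \<open>O(\<rho> * (defect b) powr (1 - \<alpha>))\<close>, exactly what the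
  assumption on \<open>V\<close> compensates.
\<close>

lemma V_increment_bound:
  assumes near: "\<rho> < 1/9" and f: "f \<in> bloch_space \<alpha>"
  shows "norm V * norm (f a - f b) \<le> lip_const \<alpha> * M * bloch_norm \<alpha> f"
proof -
  have "norm V * norm (f a - f b)
      \<le> norm V * (lip_const \<alpha> * \<rho> * defect b powr (1 - \<alpha>) * bloch_norm \<alpha> f)"
    using bloch_local_lipschitz[OF \<alpha> f b a] near
    by (intro mult_left_mono) (simp_all add: pseudo_hyp_dist_commute[of b a])
  also have "\<dots> = lip_const \<alpha> * (norm V * \<rho> * defect b powr (1 - \<alpha>)) * bloch_norm \<alpha> f" by simp
  also have "\<dots> \<le> lip_const \<alpha> * M * bloch_norm \<alpha> f"
    using M_b' lip_const_nonneg[OF \<alpha>] bloch_norm_nonneg[OF f]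
    by (intro mult_right_mono mult_left_mono)
  finally show ?thesis .
qed

text \<open>
  On the peak function, \<open>(U - V) g(a) = (U g(a) - V g(b)) - V (g(a) - g(b))\<close>.
\<close>

lemma U_minus_V_bound:
  assumes near: "\<rho> < 1/9"
  shows "norm (U - V) / defect a powr (\<alpha> - 1) \<le> value_bound * peak_const \<alpha> + lip_const \<alpha> * M * peak_const \<alpha>"
proof -
  define g where "g = bloch_peak \<alpha> a"
  note g = bloch_peak_in_space[OF \<alpha> a, folded g_def]
  have ga: "g a = of_real (defect a powr (1 - \<alpha>))"
    using peak_times_at_centre(1)[OF a DERIV_const[of 1], of \<alpha>] by (simp add: g_def)
  have "lip_const \<alpha> * M * bloch_norm \<alpha> g \<le> lip_const \<alpha> * M * peak_const \<alpha>"
    using g(2) lip_const_nonneg[OF \<alpha>] M_nonneg by (intro mult_left_mono) auto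
  then have 1: "norm (V * (g a - g b)) \<le> lip_const \<alpha> * M * peak_const \<alpha>"
    using V_increment_bound[OF near g(1)] by (simp add: norm_mult)
  have 2: "norm (U * g a - V * g b) \<le> value_bound * peak_const \<alpha>"
    using peak_value_bounded by (simp add: ga) (simp add: g_def)
  have "norm (U - V) * defect a powr (1 - \<alpha>) = norm ((U - V) * g a)" by (simp add: norm_mult ga)
  also have "(U - V) * g a = (U * g a - V * g b) - V * (g a - g b)" by (simp add: algebra_simps)
  also have "norm \<dots> \<le> value_bound * peak_const \<alpha> + lip_const \<alpha> * M * peak_const \<alpha>"
    by (intro order_trans[OF norm_triangle_ineq4] add_mono 1 2)
  finally show ?thesis
    using powr_minus[of "defect a" "\<alpha> - 1"] by (simp add: divide_inverse)
qed

end

section \<open>From the operator to pointwise functionals\<close>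

lemma self_mapsD:
  assumes "\<phi> \<in> self_maps"
  shows "\<phi> holomorphic_on unit_disk" "z \<in> unit_disk \<Longrightarrow> \<phi> z \<in> unit_disk"
  using assms by (auto simp: self_maps_def image_subset_iff)

lemma weighted_comp_has_deriv:
  assumes \<phi>: "\<phi> \<in> self_maps" and u: "u holomorphic_on unit_disk"
    and f: "f holomorphic_on unit_disk" and z: "z \<in> unit_disk"
  shows "(weighted_comp u \<phi> f has_field_derivative
    deriv u z * f (\<phi> z) + u z * (deriv f (\<phi> z) * deriv \<phi> z)) (at z)"
proof -
  have "(\<phi> has_field_derivative deriv \<phi> z) (at z)" "(u has_field_derivative deriv u z) (at z)"
    "(f has_field_derivative deriv f (\<phi> z)) (at (\<phi> z))"
    using holomorphic_derivI[OF _ open_ball] self_mapsD[OF \<phi>] u f z by blast+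
  from DERIV_mult[OF this(2) DERIV_chain2[OF this(3,1)]] show ?thesis
    unfolding weighted_comp_def by (simp add: algebra_simps)
qed

lemma weighted_deriv_difference:
  assumes \<phi>: "\<phi> \<in> self_maps" and \<psi>: "\<psi> \<in> self_maps"
    and u: "u holomorphic_on unit_disk" and v: "v holomorphic_on unit_disk"
    and f: "f holomorphic_on unit_disk" and z: "z \<in> unit_disk"
  shows "weighted_deriv \<beta> (\<lambda>z. weighted_comp u \<phi> f z - weighted_comp v \<psi> f z) z
    = weighted_deriv \<beta> u z * f (\<phi> z) - weighted_deriv \<beta> v z * f (\<psi> z)
      + u z * sharp \<alpha> \<beta> \<phi> z * weighted_deriv \<alpha> f (\<phi> z)
      - v z * sharp \<alpha> \<beta> \<psi> z * weighted_deriv \<alpha> f (\<psi> z)"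
proof -
  have cancel: "sharp \<alpha> \<beta> \<eta> z * weighted_deriv \<alpha> f (\<eta> z)
      = of_real (defect z powr \<beta>) * (deriv f (\<eta> z) * deriv \<eta> z)" if "\<eta> \<in> self_maps" for \<eta>
  proof -
    have "defect (\<eta> z) powr \<alpha> \<noteq> 0" using defect_pos[OF self_mapsD(2)[OF that z]] by simp
    then show ?thesis by (simp add: sharp_def weighted_deriv_def del: powr_eq_0_iff)
  qed
  have dT: "deriv (\<lambda>z. weighted_comp u \<phi> f z - weighted_comp v \<psi> f z) z
      = (deriv u z * f (\<phi> z) + u z * (deriv f (\<phi> z) * deriv \<phi> z))
        - (deriv v z * f (\<psi> z) + v z * (deriv f (\<psi> z) * deriv \<psi> z))"
    by (intro DERIV_imp_deriv DERIV_diff weighted_comp_has_deriv assms)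
  show ?thesis
    unfolding weighted_deriv_def[of \<beta>] dT mult.assoc cancel[OF \<phi>] cancel[OF \<psi>]
    by (simp add: algebra_simps)
qed

text \<open>
  The value of the image at the origin needs no condition of its own, since point evaluations are
  bounded on the Bloch space.
\<close>

lemma bloch_bounded_iff_pointwise:
  assumes \<alpha>: "1 < \<alpha>" and \<phi>: "\<phi> \<in> self_maps" and \<psi>: "\<psi> \<in> self_maps"
    and u: "u holomorphic_on unit_disk" and v: "v holomorphic_on unit_disk"
  shows "bloch_bounded \<alpha> \<beta> (\<lambda>f z. weighted_comp u \<phi> f z - weighted_comp v \<psi> f z) \<longleftrightarrow>
    (\<exists>C\<ge>0. \<forall>f\<in>bloch_space \<alpha>. \<forall>z\<in>unit_disk.
      norm (weighted_deriv \<beta> u z * f (\<phi> z) - weighted_deriv \<beta> v z * f (\<psi> z)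
        + u z * sharp \<alpha> \<beta> \<phi> z * weighted_deriv \<alpha> f (\<phi> z)
        - v z * sharp \<alpha> \<beta> \<psi> z * weighted_deriv \<alpha> f (\<psi> z)) \<le> C * bloch_norm \<alpha> f)"
  (is "_ \<longleftrightarrow> (\<exists>C\<ge>0. \<forall>f\<in>_. \<forall>z\<in>_. norm (?L f z) \<le> _)")
proof -
  define T where "T = (\<lambda>f z. weighted_comp u \<phi> f z - weighted_comp v \<psi> f z)"
  have L: "weighted_deriv \<beta> (T f) z = ?L f z" if "f \<in> bloch_space \<alpha>" "z \<in> unit_disk" for f z
    unfolding T_def using that by (intro weighted_deriv_difference[OF \<phi> \<psi> u v]) (auto simp: bloch_space_def)
  have "bloch_bounded \<alpha> \<beta> T \<longleftrightarrow> (\<exists>C\<ge>0. \<forall>f\<in>bloch_space \<alpha>. \<forall>z\<in>unit_disk. norm (?L f z) \<le> C * bloch_norm \<alpha> f)"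
  proof
    assume "bloch_bounded \<alpha> \<beta> T"
    then obtain C where C: "\<And>f. f \<in> bloch_space \<alpha> \<Longrightarrow> T f \<in> bloch_space \<beta>"
      "\<And>f. f \<in> bloch_space \<alpha> \<Longrightarrow> bloch_norm \<beta> (T f) \<le> C * bloch_norm \<alpha> f"
      unfolding bloch_bounded_def by blast
    have "norm (?L f z) \<le> max C 0 * bloch_norm \<alpha> f" if f: "f \<in> bloch_space \<alpha>" and z: "z \<in> unit_disk" for f z
    proof -
      have "norm (?L f z) \<le> bloch_norm \<beta> (T f)"
        using weighted_deriv_le_bloch_norm[OF C(1)[OF f] z] L[OF f z] by simp
      also have "\<dots> \<le> max C 0 * bloch_norm \<alpha> f"
        using C(2)[OF f] mult_right_mono[OF _ bloch_norm_nonneg[OF f], of C "max C 0"] by linarith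
      finally show ?thesis .
    qed
    then show "\<exists>C\<ge>0. \<forall>f\<in>bloch_space \<alpha>. \<forall>z\<in>unit_disk. norm (?L f z) \<le> C * bloch_norm \<alpha> f"
      by (intro exI[of _ "max C 0"]) auto
  next
    assume "\<exists>C\<ge>0. \<forall>f\<in>bloch_space \<alpha>. \<forall>z\<in>unit_disk. norm (?L f z) \<le> C * bloch_norm \<alpha> f"
    then obtain C where C: "\<And>f z. f \<in> bloch_space \<alpha> \<Longrightarrow> z \<in> unit_disk \<Longrightarrow> norm (?L f z) \<le> C * bloch_norm \<alpha> f"
      by blast
    have 0: "0 \<in> unit_disk" by simp
    define c where "c = norm (u 0) * (growth_const \<alpha> * defect (\<phi> 0) powr (1 - \<alpha>))
      + norm (v 0) * (growth_const \<alpha> * defect (\<psi> 0) powr (1 - \<alpha>))"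
    have "T f \<in> bloch_space \<beta> \<and> bloch_norm \<beta> (T f) \<le> (c + C) * bloch_norm \<alpha> f" if f: "f \<in> bloch_space \<alpha>" for f
    proof -
      have hol: "T f holomorphic_on unit_disk"
      proof -
        have fh: "f holomorphic_on unit_disk" using f by (simp add: bloch_space_def)
        have "(T f has_field_derivative
            (deriv u z * f (\<phi> z) + u z * (deriv f (\<phi> z) * deriv \<phi> z))
              - (deriv v z * f (\<psi> z) + v z * (deriv f (\<psi> z) * deriv \<psi> z))) (at z)" if "z \<in> unit_disk" for z
          unfolding T_def by (intro DERIV_diff weighted_comp_has_deriv \<phi> \<psi> u v fh that)
        then show ?thesis
          by (meson field_differentiable_at_within field_differentiable_def holomorphic_onI)
      qed
      have "norm (T f 0) \<le> norm (u 0) * norm (f (\<phi> 0)) + norm (v 0) * norm (f (\<psi> 0))"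
        unfolding T_def weighted_comp_def
        by (rule order_trans[OF norm_triangle_ineq4]) (simp add: norm_mult)
      also have "\<dots> \<le> norm (u 0) * (growth_const \<alpha> * defect (\<phi> 0) powr (1 - \<alpha>) * bloch_norm \<alpha> f)
          + norm (v 0) * (growth_const \<alpha> * defect (\<psi> 0) powr (1 - \<alpha>) * bloch_norm \<alpha> f)"
        by (intro add_mono mult_left_mono bloch_growth[OF \<alpha> f] self_mapsD[OF \<phi>] self_mapsD[OF \<psi>] 0 norm_ge_zero)
      also have "\<dots> = c * bloch_norm \<alpha> f" by (simp add: c_def algebra_simps)
      finally have at0: "norm (T f 0) \<le> c * bloch_norm \<alpha> f" .
      have der: "norm (weighted_deriv \<beta> (T f) z) \<le> C * bloch_norm \<alpha> f" if "z \<in> unit_disk" for z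
        using C[OF f that] L[OF f that] by simp
      show ?thesis using bloch_spaceI[OF hol at0 der] by (simp add: algebra_simps)
    qed
    then show "bloch_bounded \<alpha> \<beta> T" unfolding bloch_bounded_def by blast
  qed
  then show ?thesis by (simp only: T_def)
qed

lemma bloch_dist_commute: "bloch_dist \<alpha> a b = bloch_dist \<alpha> b a"
  by (simp add: bloch_dist_def norm_minus_commute)

text \<open>
  By homogeneity the supremum over the unit ball becomes an estimate for all functions. Functions of
  norm zero cannot be normalised; they vanish by the growth estimate.
\<close>

lemma bloch_dist_mult_le_iff:
  assumes \<alpha>: "1 < \<alpha>" and a: "a \<in> unit_disk" and b: "b \<in> unit_disk" and x: "0 \<le> x" and K: "0 \<le> K"
  shows "ereal x * bloch_dist \<alpha> a b \<le> ereal K \<longleftrightarrow>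
    (\<forall>f\<in>bloch_space \<alpha>. x * norm (f a - f b) \<le> K * bloch_norm \<alpha> f)"
proof
  assume le: "ereal x * bloch_dist \<alpha> a b \<le> ereal K"
  show "\<forall>f\<in>bloch_space \<alpha>. x * norm (f a - f b) \<le> K * bloch_norm \<alpha> f"
  proof
    fix f assume f: "f \<in> bloch_space \<alpha>"
    define N where "N = bloch_norm \<alpha> f"
    show "x * norm (f a - f b) \<le> K * bloch_norm \<alpha> f"
    proof (cases "N = 0")
      case True
      then have "f a = 0" "f b = 0"
        using bloch_growth[OF \<alpha> f a] bloch_growth[OF \<alpha> f b] by (simp_all add: N_def)
      then show ?thesis using True by (simp add: N_def)
    next
      case False
      then have N: "0 < N" using bloch_norm_nonneg[OF f] by (simp add: N_def)
      define g where "g = (\<lambda>z. f z / of_real N)"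
      have holf: "f holomorphic_on unit_disk" using f by (simp add: bloch_space_def)
      have hol: "g holomorphic_on unit_disk"
        unfolding g_def using N by (intro holomorphic_intros holf) auto
      have g0: "norm (g 0) \<le> norm (f 0) / N" using N by (simp add: g_def norm_divide)
      have gz: "norm (weighted_deriv \<alpha> g z) \<le> bloch_seminorm \<alpha> f / N" if z: "z \<in> unit_disk" for z
      proof -
        have "deriv g z = deriv f z / of_real N"
          unfolding g_def
          by (intro DERIV_imp_deriv DERIV_cdivide holomorphic_derivI[OF holf open_ball z])
        then have "norm (weighted_deriv \<alpha> g z) = norm (weighted_deriv \<alpha> f z) / N"
          using N by (simp add: weighted_deriv_def norm_mult norm_divide)
        then show ?thesis
          using weighted_deriv_le_seminorm[OF f z] N by (simp add: divide_right_mono)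
      qed
      have "norm (f 0) / N + bloch_seminorm \<alpha> f / N = 1"
        using N by (simp add: N_def bloch_norm_def flip: add_divide_distrib)
      then have "g \<in> {f \<in> bloch_space \<alpha>. bloch_norm \<alpha> f \<le> 1}"
        using bloch_spaceI[OF hol g0 gz] by simp
      then have "ereal (norm (g a - g b)) \<le> bloch_dist \<alpha> a b"
        unfolding bloch_dist_def by (rule SUP_upper)
      then have "ereal x * ereal (norm (g a - g b)) \<le> ereal x * bloch_dist \<alpha> a b"
        using x by (intro ereal_mult_left_mono) auto
      with le have "ereal (x * norm (g a - g b)) \<le> ereal K"
        by (metis order_trans times_ereal.simps(1))
      then have "x * norm (g a - g b) \<le> K" by simp
      moreover have "norm (g a - g b) = norm (f a - f b) / N"
        using N by (simp add: g_def norm_divide flip: diff_divide_distrib)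
      ultimately show ?thesis using N by (simp add: N_def[symmetric] field_simps)
    qed
  qed
next
  assume le: "\<forall>f\<in>bloch_space \<alpha>. x * norm (f a - f b) \<le> K * bloch_norm \<alpha> f"
  show "ereal x * bloch_dist \<alpha> a b \<le> ereal K"
  proof (cases "x = 0")
    case True
    then show ?thesis using K by (simp flip: zero_ereal_def)
  next
    case False
    then have x0: "0 < x" using x by simp
    have "bloch_dist \<alpha> a b \<le> ereal (K / x)"
      unfolding bloch_dist_def
    proof (rule SUP_least)
      fix f assume "f \<in> {f \<in> bloch_space \<alpha>. bloch_norm \<alpha> f \<le> 1}"
      then have f: "f \<in> bloch_space \<alpha>" "bloch_norm \<alpha> f \<le> 1" by auto
      have "x * norm (f a - f b) \<le> K * 1"
        using le f(1) mult_left_mono[OF f(2) K] by (meson order_trans)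
      then show "ereal (norm (f a - f b)) \<le> ereal (K / x)"
        using x0 by (simp add: field_simps)
    qed
    then have "ereal x * bloch_dist \<alpha> a b \<le> ereal x * ereal (K / x)"
      using x by (intro ereal_mult_left_mono) auto
    then show ?thesis using x0 by simp
  qed
qed

text \<open>
  By the growth estimate a bounded quotient \<open>W / (defect c) powr (\<alpha> - 1)\<close> bounds \<open>W f(c)\<close>. This
  settles the first case term by term; in the other two it is applied to the coefficient \<open>U - V\<close> at
  one of the points, and \<open>bloch_dist\<close> controls the remaining increment of \<open>f\<close>.
\<close>

lemma value_part_bound_cases:
  assumes \<alpha>: "1 < \<alpha>" and a: "a \<in> unit_disk" and b: "b \<in> unit_disk"
    and f: "f \<in> bloch_space \<alpha>" and K: "0 \<le> K"
    and cases: "norm U / defect a powr (\<alpha> - 1) \<le> K \<and> norm V / defect b powr (\<alpha> - 1) \<le> K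
      \<or> norm (U - V) / defect a powr (\<alpha> - 1) \<le> K \<and> ereal (norm V) * bloch_dist \<alpha> a b \<le> ereal K
      \<or> norm (U - V) / defect b powr (\<alpha> - 1) \<le> K \<and> ereal (norm U) * bloch_dist \<alpha> a b \<le> ereal K"
  shows "norm (U * f a - V * f b) \<le> (2 * growth_const \<alpha> + 1) * K * bloch_norm \<alpha> f"
proof -
  let ?N = "bloch_norm \<alpha> f" and ?G = "growth_const \<alpha>"
  have N: "0 \<le> ?N" by (rule bloch_norm_nonneg[OF f])
  have G: "0 \<le> ?G" by (rule growth_const_nonneg[OF \<alpha>])
  have grow: "norm (W * f c) \<le> ?G * K * ?N"
    if c: "c \<in> unit_disk" and W: "norm W / defect c powr (\<alpha> - 1) \<le> K" for W c
  proof -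
    have "norm (W * f c) \<le> norm W * (?G * defect c powr (1 - \<alpha>) * ?N)"
      unfolding norm_mult by (intro mult_left_mono bloch_growth[OF \<alpha> f c]) simp
    also have "\<dots> = ?G * (norm W / defect c powr (\<alpha> - 1)) * ?N"
      using powr_minus[of "defect c" "\<alpha> - 1"] by (simp add: divide_inverse)
    also have "\<dots> \<le> ?G * K * ?N" using W G N by (intro mult_right_mono mult_left_mono)
    finally show ?thesis .
  qed
  have incr: "norm (W * (f a - f b)) \<le> K * ?N"
    if "ereal (norm W) * bloch_dist \<alpha> a b \<le> ereal K" for W
    using that f bloch_dist_mult_le_iff[OF \<alpha> a b norm_ge_zero[of W] K] by (simp add: norm_mult)
  have nn: "0 \<le> ?G * K * ?N" "0 \<le> K * ?N" using G K N by auto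
  from cases consider
      "norm (U * f a) \<le> ?G * K * ?N" "norm (V * f b) \<le> ?G * K * ?N"
    | "norm ((U - V) * f a) \<le> ?G * K * ?N" "norm (V * (f a - f b)) \<le> K * ?N"
    | "norm ((U - V) * f b) \<le> ?G * K * ?N" "norm (U * (f a - f b)) \<le> K * ?N"
    using grow[OF a] grow[OF b] incr by blast
  then have "norm (U * f a - V * f b) \<le> 2 * (?G * K * ?N) + K * ?N"
  proof cases
    case 1
    then show ?thesis using norm_triangle_ineq4[of "U * f a" "V * f b"] nn by linarith
  next
    case 2
    moreover have "U * f a - V * f b = (U - V) * f a + V * (f a - f b)" by (simp add: algebra_simps)
    ultimately show ?thesis using norm_triangle_ineq[of "(U - V) * f a" "V * (f a - f b)"] nn by simp
  next
    case 3
    moreover have "U * f a - V * f b = (U - V) * f b + U * (f a - f b)" by (simp add: algebra_simps)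
    ultimately show ?thesis using norm_triangle_ineq[of "(U - V) * f b" "U * (f a - f b)"] nn by simp
  qed
  then show ?thesis by (simp add: algebra_simps)
qed

section \<open>Sequences tending to the unit circle\<close>

lemma SUP_ereal_finite_iff:
  "(SUP z\<in>A. ereal (h z)) < \<infinity> \<longleftrightarrow> (\<exists>M. \<forall>z\<in>A. h z \<le> M)"
proof
  assume "(SUP z\<in>A. ereal (h z)) < \<infinity>"
  then obtain M where "(SUP z\<in>A. ereal (h z)) < ereal M"
    using less_PInf_Ex_of_nat by (metis less_irrefl)
  then have "ereal (h z) \<le> ereal M" if "z \<in> A" for z
    using SUP_upper[OF that, of "\<lambda>z. ereal (h z)"] by (meson less_imp_le order_trans)
  then show "\<exists>M. \<forall>z\<in>A. h z \<le> M" by auto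
next
  assume "\<exists>M. \<forall>z\<in>A. h z \<le> M"
  then obtain M where "\<forall>z\<in>A. h z \<le> M" by blast
  then have "(SUP z\<in>A. ereal (h z)) \<le> ereal M" by (intro SUP_least) auto
  then show "(SUP z\<in>A. ereal (h z)) < \<infinity>" by (rule order.strict_trans1) simp
qed

text \<open>
  Otherwise, for every \<open>n\<close> some point with \<open>1 - 1/(n+1) < |z|\<close> has \<open>h z > n\<close> and \<open>k z > n\<close>; these
  points form an admissible sequence along which the upper limit is infinite.
\<close>

lemma boundary_limsup_uniform:
  assumes fin: "(SUP s\<in>boundary_seqs_infinity h. limsup (\<lambda>n. k (s n))) < (\<infinity> :: ereal)"
  obtains K r where "r < 1"
    "\<And>z. z \<in> unit_disk \<Longrightarrow> r < norm z \<Longrightarrow> K < h z \<Longrightarrow> k z \<le> ereal K"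
proof -
  have "\<exists>K. \<exists>r<1. \<forall>z\<in>unit_disk. r < norm z \<longrightarrow> K < h z \<longrightarrow> k z \<le> ereal K"
  proof (rule ccontr)
    assume "\<not> ?thesis"
    then have neg: "\<And>K r. r < 1 \<Longrightarrow> \<exists>z\<in>unit_disk. r < norm z \<and> K < h z \<and> ereal K < k z"
      by (meson not_le)
    have "\<exists>z\<in>unit_disk. 1 - 1 / real (Suc n) < norm z \<and> real n < h z \<and> ereal (real n) < k z" for n
      by (rule neg) simp
    then obtain s where s: "\<And>n. s n \<in> unit_disk" "\<And>n. 1 - 1 / real (Suc n) < norm (s n)"
      "\<And>n. real n < h (s n)" "\<And>n. ereal (real n) < k (s n)"
      by metis
    have "(\<lambda>n. norm (s n)) \<longlonglongrightarrow> 1"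
    proof (rule tendsto_sandwich)
      show "(\<lambda>n. 1 - 1 / real (Suc n)) \<longlonglongrightarrow> 1"
        using tendsto_diff[OF tendsto_const LIMSEQ_inverse_real_of_nat, of 1]
        by (simp add: inverse_eq_divide)
      show "\<forall>\<^sub>F n in sequentially. 1 - 1 / real (Suc n) \<le> norm (s n)"
        using s(2) by (intro always_eventually allI less_imp_le)
      show "\<forall>\<^sub>F n in sequentially. norm (s n) \<le> 1"
        using s(1) by (intro always_eventually allI less_imp_le) simp
    qed simp
    moreover have "filterlim (\<lambda>n. h (s n)) at_top sequentially"
      using s(3) by (intro filterlim_at_top_mono[OF filterlim_real_sequentially] always_eventually)
        (auto intro: less_imp_le)
    ultimately have "s \<in> boundary_seqs_infinity h"
      using s(1) by (simp add: boundary_seqs_infinity_def)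
    then have "limsup (\<lambda>n. k (s n)) < \<infinity>"
      using fin SUP_upper[of s _ "\<lambda>s. limsup (\<lambda>n. k (s n))"] by (metis order.strict_trans1)
    moreover have "limsup (\<lambda>n. ereal (real n)) \<le> limsup (\<lambda>n. k (s n))"
      using s(4) by (intro Limsup_mono always_eventually allI less_imp_le)
    moreover have "limsup (\<lambda>n. ereal (real n)) = \<infinity>"
      by (intro lim_imp_Limsup) (simp_all add: id_nat_ereal_tendsto_PInf)
    ultimately show False by simp
  qed
  then show thesis using that by blast
qed

lemma boundary_limsup_finite:
  assumes "\<And>z. z \<in> unit_disk \<Longrightarrow> K0 < h z \<Longrightarrow> k z \<le> ereal K"
  shows "(SUP s\<in>boundary_seqs_infinity h. limsup (\<lambda>n. k (s n))) < \<infinity>"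
proof -
  have "(SUP s\<in>boundary_seqs_infinity h. limsup (\<lambda>n. k (s n))) \<le> ereal K"
  proof (rule SUP_least)
    fix s assume "s \<in> boundary_seqs_infinity h"
    then have s: "\<And>n. s n \<in> unit_disk" "filterlim (\<lambda>n. h (s n)) at_top sequentially"
      by (auto simp: boundary_seqs_infinity_def)
    have "\<forall>\<^sub>F n in sequentially. K0 < h (s n)"
      using s(2) by (simp add: filterlim_at_top_dense)
    then have "\<forall>\<^sub>F n in sequentially. k (s n) \<le> ereal K"
      by eventually_elim (rule assms[OF s(1)])
    then show "limsup (\<lambda>n. k (s n)) \<le> ereal K" by (rule Limsup_bounded)
  qed
  then show ?thesis by (rule order.strict_trans1) simp
qed

text \<open>
  This turns mutual domination of two functions into equality of their sets of sequences.
\<close>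

lemma boundary_seqs_infinity_mono:
  assumes B: "0 < B" and le: "\<And>z. z \<in> unit_disk \<Longrightarrow> h z \<le> A + B * k z"
  shows "boundary_seqs_infinity h \<subseteq> boundary_seqs_infinity k"
proof
  fix s assume "s \<in> boundary_seqs_infinity h"
  then have s: "\<And>n. s n \<in> unit_disk" "(\<lambda>n. norm (s n)) \<longlonglongrightarrow> 1" "filterlim (\<lambda>n. h (s n)) at_top sequentially"
    by (auto simp: boundary_seqs_infinity_def)
  have "\<forall>\<^sub>F n in sequentially. Z < k (s n)" for Z
  proof -
    have "\<forall>\<^sub>F n in sequentially. A + B * Z < h (s n)"
      using s(3) by (simp add: filterlim_at_top_dense)
    then show ?thesis
    proof eventually_elim
      case (elim n)
      then have "B * Z < B * k (s n)" using le[OF s(1)[of n]] by linarith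
      then show ?case using B by simp
    qed
  qed
  then show "s \<in> boundary_seqs_infinity k"
    using s(1,2) by (simp add: boundary_seqs_infinity_def filterlim_at_top_dense)
qed

lemma weighted_deriv_quotient_bounded:
  assumes u: "u holomorphic_on unit_disk" and \<phi>: "\<phi> \<in> self_maps" and r: "r < 1"
  obtains K where "\<And>z. norm z \<le> r \<Longrightarrow> norm (weighted_deriv \<beta> u z) / defect (\<phi> z) powr \<gamma> \<le> K"
proof -
  have sub: "cball 0 r \<subseteq> unit_disk" using r by auto
  have c1: "continuous_on (cball 0 r) (deriv u)"
    using holomorphic_deriv[OF u open_ball] sub
    by (meson holomorphic_on_imp_continuous_on holomorphic_on_subset)
  have c2: "continuous_on (cball 0 r) \<phi>"
    using self_mapsD(1)[OF \<phi>] sub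
    by (meson holomorphic_on_imp_continuous_on holomorphic_on_subset)
  have nz: "defect z \<noteq> 0" "defect (\<phi> z) \<noteq> 0" if "z \<in> cball 0 r" for z
    using defect_pos[of z] defect_pos[OF self_mapsD(2)[OF \<phi>, of z]] sub that by fastforce+
  have "continuous_on (cball 0 r) (\<lambda>z. norm (weighted_deriv \<beta> u z) / defect (\<phi> z) powr \<gamma>)"
    unfolding weighted_deriv_def using nz by (intro continuous_intros c1 c2) auto
  from compact_continuous_image[OF this compact_cball]
  obtain K where "\<forall>z\<in>cball 0 r. norm (weighted_deriv \<beta> u z) / defect (\<phi> z) powr \<gamma> \<le> K"
    using bounded_imp_bdd_above[OF compact_imp_bounded] by (fastforce simp: bdd_above_def)
  then show thesis by (intro that[of K]) simp
qed

section \<open>The characterisation\<close>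

theorem theorem3p1:
  fixes \<alpha> \<beta> :: real and \<phi> \<psi> u v :: "complex \<Rightarrow> complex"
  defines "U \<equiv> weighted_deriv \<beta> u"
    and "V \<equiv> weighted_deriv \<beta> v"
    and "\<rho> \<equiv> \<lambda>z. pseudo_hyp_dist (\<phi> z) (\<psi> z)"
    and "d \<equiv> \<lambda>z. bloch_dist \<alpha> (\<phi> z) (\<psi> z)"
  assumes "\<alpha> > 1" and "\<beta> > 0"
    and "\<phi> \<in> self_maps" and "\<psi> \<in> self_maps"
    and "u holomorphic_on unit_disk" and "v holomorphic_on unit_disk"
    and "(SUP z\<in>unit_disk. ereal (norm (U z) * \<rho> z / (1 - (norm (\<phi> z))\<^sup>2) powr (\<alpha> - 1))) < \<infinity>"
    and "(SUP z\<in>unit_disk. ereal (norm (V z) * \<rho> z / (1 - (norm (\<psi> z))\<^sup>2) powr (\<alpha> - 1))) < \<infinity>"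
  shows "bloch_bounded \<alpha> \<beta> (\<lambda>f z. weighted_comp u \<phi> f z - weighted_comp v \<psi> f z) \<longleftrightarrow>
      D_seqs \<alpha> \<beta> u \<phi> = D_seqs \<alpha> \<beta> v \<psi>
    \<and> (SUP z\<in>unit_disk. ereal (norm (u z * sharp \<alpha> \<beta> \<phi> z - v z * sharp \<alpha> \<beta> \<psi> z))) < \<infinity>
    \<and> ((SUP z\<in>unit_disk. ereal (norm (u z * sharp \<alpha> \<beta> \<phi> z) * \<rho> z)) < \<infinity>
       \<and> (SUP z\<in>unit_disk. ereal (norm (v z * sharp \<alpha> \<beta> \<psi> z) * \<rho> z)) < \<infinity>)
    \<and> E_seqs \<alpha> \<beta> u \<phi> = E_seqs \<alpha> \<beta> v \<psi>
    \<and> ((SUP s\<in>E_seqs \<alpha> \<beta> u \<phi>.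
          limsup (\<lambda>n. ereal (norm (U (s n) - V (s n)) / (1 - (norm (\<phi> (s n)))\<^sup>2) powr (\<alpha> - 1)))) < \<infinity>
       \<and> (SUP s\<in>E_seqs \<alpha> \<beta> v \<psi>.
          limsup (\<lambda>n. ereal (norm (U (s n) - V (s n)) / (1 - (norm (\<psi> (s n)))\<^sup>2) powr (\<alpha> - 1)))) < \<infinity>)
    \<and> ((SUP s\<in>E_seqs \<alpha> \<beta> u \<phi>. limsup (\<lambda>n. ereal (norm (U (s n))) * d (s n))) < \<infinity>
       \<and> (SUP s\<in>E_seqs \<alpha> \<beta> v \<psi>. limsup (\<lambda>n. ereal (norm (V (s n))) * d (s n))) < \<infinity>)"
proof -
  note \<alpha> = \<open>1 < \<alpha>\<close> and \<phi> = \<open>\<phi> \<in> self_maps\<close> and \<psi> = \<open>\<psi> \<in> self_maps\<close>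
    and u = \<open>u holomorphic_on unit_disk\<close> and v = \<open>v holomorphic_on unit_disk\<close>
  define p q where "p = (\<lambda>z. u z * sharp \<alpha> \<beta> \<phi> z)" and "q = (\<lambda>z. v z * sharp \<alpha> \<beta> \<psi> z)"
  define A B where "A = (\<lambda>z. norm (U z) / defect (\<phi> z) powr (\<alpha> - 1))"
    and "B = (\<lambda>z. norm (V z) / defect (\<psi> z) powr (\<alpha> - 1))"
  obtain M1 M2 where
      M1: "\<And>z. z \<in> unit_disk \<Longrightarrow> norm (U z) * \<rho> z / defect (\<phi> z) powr (\<alpha> - 1) \<le> M1"
    and M2: "\<And>z. z \<in> unit_disk \<Longrightarrow> norm (V z) * \<rho> z / defect (\<psi> z) powr (\<alpha> - 1) \<le> M2"
    using assms(11,12) unfolding SUP_ereal_finite_iff by blast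
  have Eu: "E_seqs \<alpha> \<beta> u \<phi> = boundary_seqs_infinity A" and Ev: "E_seqs \<alpha> \<beta> v \<psi> = boundary_seqs_infinity B"
    by (simp_all add: E_seqs_def A_def B_def U_def V_def)
  have Du: "D_seqs \<alpha> \<beta> u \<phi> = boundary_seqs_infinity (\<lambda>z. norm (p z))"
    and Dv: "D_seqs \<alpha> \<beta> v \<psi> = boundary_seqs_infinity (\<lambda>z. norm (q z))"
    by (simp_all add: D_seqs_def p_def q_def)
  let ?kA = "\<lambda>z. ereal (norm (U z - V z) / defect (\<phi> z) powr (\<alpha> - 1))"
    and ?kB = "\<lambda>z. ereal (norm (U z - V z) / defect (\<psi> z) powr (\<alpha> - 1))"
    and ?dU = "\<lambda>z. ereal (norm (U z)) * d z" and ?dV = "\<lambda>z. ereal (norm (V z)) * d z"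
  have in_disk: "\<phi> z \<in> unit_disk" "\<psi> z \<in> unit_disk" if "z \<in> unit_disk" for z
    using that self_mapsD(2)[OF \<phi>] self_mapsD(2)[OF \<psi>] by blast+
  have bounded_iff: "bloch_bounded \<alpha> \<beta> (\<lambda>f z. weighted_comp u \<phi> f z - weighted_comp v \<psi> f z) \<longleftrightarrow>
      (\<exists>C\<ge>0. \<forall>f\<in>bloch_space \<alpha>. \<forall>z\<in>unit_disk.
        norm (U z * f (\<phi> z) - V z * f (\<psi> z) + p z * weighted_deriv \<alpha> f (\<phi> z)
          - q z * weighted_deriv \<alpha> f (\<psi> z)) \<le> C * bloch_norm \<alpha> f)"
    unfolding U_def V_def p_def q_def by (rule bloch_bounded_iff_pointwise[OF \<alpha> \<phi> \<psi> u v])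
  have necessity: "boundary_seqs_infinity (\<lambda>z. norm (p z)) = boundary_seqs_infinity (\<lambda>z. norm (q z))
      \<and> (\<exists>K. \<forall>z\<in>unit_disk. norm (p z - q z) \<le> K)
      \<and> ((\<exists>K. \<forall>z\<in>unit_disk. norm (p z) * \<rho> z \<le> K) \<and> (\<exists>K. \<forall>z\<in>unit_disk. norm (q z) * \<rho> z \<le> K))
      \<and> boundary_seqs_infinity A = boundary_seqs_infinity B
      \<and> ((SUP s\<in>boundary_seqs_infinity A. limsup (\<lambda>n. ?kA (s n))) < \<infinity>
         \<and> (SUP s\<in>boundary_seqs_infinity B. limsup (\<lambda>n. ?kB (s n))) < \<infinity>)
      \<and> ((SUP s\<in>boundary_seqs_infinity A. limsup (\<lambda>n. ?dU (s n))) < \<infinity>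
         \<and> (SUP s\<in>boundary_seqs_infinity B. limsup (\<lambda>n. ?dV (s n))) < \<infinity>)"
    if C: "0 \<le> C" "\<And>f z. f \<in> bloch_space \<alpha> \<Longrightarrow> z \<in> unit_disk \<Longrightarrow>
        norm (U z * f (\<phi> z) - V z * f (\<psi> z) + p z * weighted_deriv \<alpha> f (\<phi> z)
          - q z * weighted_deriv \<alpha> f (\<psi> z)) \<le> C * bloch_norm \<alpha> f" for C
  proof -
    define M where "M = max M1 M2"
    have F: "bloch_functional \<alpha> C M (\<phi> z) (\<psi> z) (U z) (V z) (p z) (q z)" if z: "z \<in> unit_disk" for z
    proof
      show "norm (U z) * pseudo_hyp_dist (\<phi> z) (\<psi> z) / defect (\<phi> z) powr (\<alpha> - 1) \<le> M"
        "norm (V z) * pseudo_hyp_dist (\<phi> z) (\<psi> z) / defect (\<psi> z) powr (\<alpha> - 1) \<le> M"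
        using M1[OF z] M2[OF z] by (simp_all add: M_def \<rho>_def)
    qed (use \<alpha> in_disk[OF z] C z in auto)
    have F': "bloch_functional \<alpha> C M (\<psi> z) (\<phi> z) (V z) (U z) (q z) (p z)" if "z \<in> unit_disk" for z
      by (rule bloch_functional.swap[OF F[OF that]])
    have sym: "pseudo_hyp_dist (\<psi> z) (\<phi> z) = \<rho> z" "bloch_dist \<alpha> (\<psi> z) (\<phi> z) = d z" for z
      unfolding \<rho>_def d_def by (rule pseudo_hyp_dist_commute bloch_dist_commute)+
    define P Q S where "P = bloch_functional.sharp_rho_bound \<alpha> C M" and "Q = bloch_functional.sharp_diff_bound \<alpha> C M"
      and "S = bloch_functional.value_bound \<alpha> C M"
    note const_defs = P_def Q_def S_def
    have p_rho: "norm (p z) * \<rho> z \<le> P" and q_rho: "norm (q z) * \<rho> z \<le> P"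
      and pq: "norm (p z - q z) \<le> Q" if "z \<in> unit_disk" for z
      using bloch_functional.p_rho[OF F[OF that]] bloch_functional.q_rho[OF F[OF that]]
        bloch_functional.p_minus_q[OF F[OF that]] by (simp_all add: const_defs \<rho>_def)
    have D: "boundary_seqs_infinity (\<lambda>z. norm (p z)) = boundary_seqs_infinity (\<lambda>z. norm (q z))"
    proof (intro equalityI boundary_seqs_infinity_mono[where A = Q and B = 1])
      fix z assume "z \<in> unit_disk"
      from pq[OF this] show "norm (p z) \<le> Q + 1 * norm (q z)" "norm (q z) \<le> Q + 1 * norm (p z)"
        using norm_triangle_ineq2[of "p z" "q z"] norm_triangle_ineq3[of "p z" "q z"] by linarith+
    qed auto
    have E: "boundary_seqs_infinity A = boundary_seqs_infinity B"
    proof (intro equalityI boundary_seqs_infinity_mono[where A = "S * peak_const \<alpha>" and B = "2 powr \<alpha>"])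
      fix z assume z: "z \<in> unit_disk"
      show "A z \<le> S * peak_const \<alpha> + 2 powr \<alpha> * B z"
        using bloch_functional.U_dominated[OF F[OF z]] by (simp add: A_def B_def const_defs)
      show "B z \<le> S * peak_const \<alpha> + 2 powr \<alpha> * A z"
        using bloch_functional.U_dominated[OF F'[OF z]] by (simp add: A_def B_def const_defs)
    qed auto
    \<comment> \<open>A growth quotient above \<open>9 M\<close> forces the two image points together, since its product with \<open>\<rho>\<close> is at most \<open>M\<close>.\<close>
    have near: "\<rho> z < 1/9" if "z \<in> unit_disk" "9 * M < A z \<or> 9 * M < B z" for z
    proof (rule ccontr)
      assume "\<not> \<rho> z < 1/9"
      then have "1/9 * A z \<le> \<rho> z * A z" "1/9 * B z \<le> \<rho> z * B z"
        by (intro mult_right_mono; simp add: A_def B_def)+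
      moreover have "\<rho> z * A z \<le> M" "\<rho> z * B z \<le> M"
        using M1[OF that(1)] M2[OF that(1)] by (simp_all add: A_def B_def M_def mult.commute)
      ultimately show False using that(2) by linarith
    qed
    define K where "K = S * peak_const \<alpha> + lip_const \<alpha> * M * peak_const \<alpha>"
    have M0: "0 \<le> lip_const \<alpha> * M"
      using bloch_functional.M_nonneg[OF F[of 0]] lip_const_nonneg[OF \<alpha>] by simp
    have kA: "?kA z \<le> ereal K" and dV: "?dV z \<le> ereal (lip_const \<alpha> * M)"
      and kB: "?kB z \<le> ereal K" and dU: "?dU z \<le> ereal (lip_const \<alpha> * M)"
      if z: "z \<in> unit_disk" and large: "9 * M < A z \<or> 9 * M < B z" for z
    proof -
      have n: "pseudo_hyp_dist (\<phi> z) (\<psi> z) < 1/9" "pseudo_hyp_dist (\<psi> z) (\<phi> z) < 1/9"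
        using near[OF z large] sym(1) by (simp_all add: \<rho>_def)
      show "?kA z \<le> ereal K" "?kB z \<le> ereal K"
        using bloch_functional.U_minus_V_bound[OF F[OF z] n(1)]
          bloch_functional.U_minus_V_bound[OF F'[OF z] n(2)]
        by (simp_all add: K_def const_defs norm_minus_commute)
      show "?dV z \<le> ereal (lip_const \<alpha> * M)" "?dU z \<le> ereal (lip_const \<alpha> * M)"
        using bloch_functional.V_increment_bound[OF F[OF z] n(1)]
          bloch_functional.V_increment_bound[OF F'[OF z] n(2)]
          bloch_dist_mult_le_iff[OF \<alpha> in_disk[OF z] norm_ge_zero[of "V z"] M0]
          bloch_dist_mult_le_iff[OF \<alpha> in_disk(2,1)[OF z] norm_ge_zero[of "U z"] M0] sym(2)[of z]
        by (simp_all add: d_def)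
    qed
    have "(SUP s\<in>boundary_seqs_infinity A. limsup (\<lambda>n. ?kA (s n))) < \<infinity>"
      "(SUP s\<in>boundary_seqs_infinity A. limsup (\<lambda>n. ?dU (s n))) < \<infinity>"
      "(SUP s\<in>boundary_seqs_infinity B. limsup (\<lambda>n. ?kB (s n))) < \<infinity>"
      "(SUP s\<in>boundary_seqs_infinity B. limsup (\<lambda>n. ?dV (s n))) < \<infinity>"
      using boundary_limsup_finite[of "9 * M" A ?kA K] boundary_limsup_finite[of "9 * M" A ?dU "lip_const \<alpha> * M"]
        boundary_limsup_finite[of "9 * M" B ?kB K] boundary_limsup_finite[of "9 * M" B ?dV "lip_const \<alpha> * M"]
        kA kB dU dV by blast+
    then show ?thesis using D E pq p_rho q_rho by blast
  qed
  have sufficiency: "\<exists>C\<ge>0. \<forall>f\<in>bloch_space \<alpha>. \<forall>z\<in>unit_disk.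
        norm (U z * f (\<phi> z) - V z * f (\<psi> z) + p z * weighted_deriv \<alpha> f (\<phi> z)
          - q z * weighted_deriv \<alpha> f (\<psi> z)) \<le> C * bloch_norm \<alpha> f"
    if pq: "\<And>z. z \<in> unit_disk \<Longrightarrow> norm (p z - q z) \<le> Q"
      and q_rho: "\<And>z. z \<in> unit_disk \<Longrightarrow> norm (q z) * \<rho> z \<le> P"
      and E: "boundary_seqs_infinity A = boundary_seqs_infinity B"
      and kA: "(SUP s\<in>boundary_seqs_infinity A. limsup (\<lambda>n. ?kA (s n))) < \<infinity>"
      and kB: "(SUP s\<in>boundary_seqs_infinity B. limsup (\<lambda>n. ?kB (s n))) < \<infinity>"
      and dU: "(SUP s\<in>boundary_seqs_infinity A. limsup (\<lambda>n. ?dU (s n))) < \<infinity>"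
      and dV: "(SUP s\<in>boundary_seqs_infinity B. limsup (\<lambda>n. ?dV (s n))) < \<infinity>" for P Q
  proof -
    \<comment> \<open>Because the two classes of sequences agree, \<open>?dV\<close> is controlled where \<open>A\<close> is large and \<open>?dU\<close> where \<open>B\<close> is large.\<close>
    obtain K1 r1 where 1: "r1 < 1" "\<And>z. z \<in> unit_disk \<Longrightarrow> r1 < norm z \<Longrightarrow> K1 < A z \<Longrightarrow> ?kA z \<le> ereal K1"
      using boundary_limsup_uniform[where h = A and k = ?kA] kA by blast
    obtain K2 r2 where 2: "r2 < 1" "\<And>z. z \<in> unit_disk \<Longrightarrow> r2 < norm z \<Longrightarrow> K2 < A z \<Longrightarrow> ?dV z \<le> ereal K2"
      using boundary_limsup_uniform[where h = A and k = ?dV] dV E by metis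
    obtain K3 r3 where 3: "r3 < 1" "\<And>z. z \<in> unit_disk \<Longrightarrow> r3 < norm z \<Longrightarrow> K3 < B z \<Longrightarrow> ?kB z \<le> ereal K3"
      using boundary_limsup_uniform[where h = B and k = ?kB] kB by blast
    obtain K4 r4 where 4: "r4 < 1" "\<And>z. z \<in> unit_disk \<Longrightarrow> r4 < norm z \<Longrightarrow> K4 < B z \<Longrightarrow> ?dU z \<le> ereal K4"
      using boundary_limsup_uniform[where h = B and k = ?dU] dU E by metis
    define r where "r = max (max r1 r2) (max r3 r4)"
    have r: "r < 1" using 1 2 3 4 by (simp add: r_def)
    \<comment> \<open>Away from the unit circle both quotients are bounded by compactness.\<close>
    obtain K5 where 5: "\<And>z. norm z \<le> r \<Longrightarrow> A z \<le> K5"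
      using weighted_deriv_quotient_bounded[OF u \<phi> r] unfolding A_def U_def by blast
    obtain K6 where 6: "\<And>z. norm z \<le> r \<Longrightarrow> B z \<le> K6"
      using weighted_deriv_quotient_bounded[OF v \<psi> r] unfolding B_def V_def by blast
    define K where "K = Max {0, K1, K2, K3, K4, K5, K6}"
    have K_max: "x \<le> K" if "x \<in> {0, K1, K2, K3, K4, K5, K6}" for x
      unfolding K_def using that by (intro Max_ge) (rule finite.intros | assumption)+
    have K: "0 \<le> K" "K1 \<le> K" "K2 \<le> K" "K3 \<le> K" "K4 \<le> K" "K5 \<le> K" "K6 \<le> K"
      by (rule K_max; blast)+
    have cases: "A z \<le> K \<and> B z \<le> K \<or> ?kA z \<le> ereal K \<and> ?dV z \<le> ereal K
        \<or> ?kB z \<le> ereal K \<and> ?dU z \<le> ereal K" if z: "z \<in> unit_disk" for z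
    proof (cases "norm z \<le> r")
      case True
      then show ?thesis using 5[OF True] 6[OF True] K by linarith
    next
      case False
      then have lt: "r1 < norm z" "r2 < norm z" "r3 < norm z" "r4 < norm z" by (auto simp: r_def)
      have up: "x \<le> ereal K" if "x \<le> ereal k" "k \<le> K" for x k
        using that by (meson ereal_less_eq(3) order_trans)
      have "K < A z \<Longrightarrow> ?kA z \<le> ereal K \<and> ?dV z \<le> ereal K"
        using 1(2)[OF z lt(1)] 2(2)[OF z lt(2)] K up by (meson order.strict_trans1)
      moreover have "K < B z \<Longrightarrow> ?kB z \<le> ereal K \<and> ?dU z \<le> ereal K"
        using 3(2)[OF z lt(3)] 4(2)[OF z lt(4)] K up by (meson order.strict_trans1)
      ultimately show ?thesis by force
    qed
    define C where "C = (2 * growth_const \<alpha> + 1) * K + (Q + P * lip_const \<alpha>)"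
    have bound: "norm (U z * f (\<phi> z) - V z * f (\<psi> z) + p z * weighted_deriv \<alpha> f (\<phi> z)
          - q z * weighted_deriv \<alpha> f (\<psi> z)) \<le> C * bloch_norm \<alpha> f"
      if f: "f \<in> bloch_space \<alpha>" and z: "z \<in> unit_disk" for f z
    proof -
      have "norm (U z * f (\<phi> z) - V z * f (\<psi> z)) \<le> (2 * growth_const \<alpha> + 1) * K * bloch_norm \<alpha> f"
        using cases[OF z] unfolding A_def B_def d_def ereal_less_eq(3)
        by (intro value_part_bound_cases[OF \<alpha> in_disk[OF z] f K(1)])
      moreover have "norm (p z * weighted_deriv \<alpha> f (\<phi> z) - q z * weighted_deriv \<alpha> f (\<psi> z))
          \<le> (Q + P * lip_const \<alpha>) * bloch_norm \<alpha> f"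
        using q_rho[OF z] unfolding \<rho>_def
        by (intro derivative_part_bound[OF \<alpha> in_disk[OF z] pq[OF z] _ f])
      ultimately show ?thesis
        using norm_triangle_ineq[of "U z * f (\<phi> z) - V z * f (\<psi> z)"
            "p z * weighted_deriv \<alpha> f (\<phi> z) - q z * weighted_deriv \<alpha> f (\<psi> z)"]
        by (simp add: C_def algebra_simps)
    qed
    have "0 \<le> C"
    proof -
      have z: "0 \<in> unit_disk" by simp
      have "0 \<le> P" by (rule order_trans[OF _ q_rho[OF z]]) (simp add: \<rho>_def pseudo_hyp_dist_nonneg)
      moreover have "0 \<le> Q" by (rule order_trans[OF norm_ge_zero pq[OF z]])
      ultimately show ?thesis
        using K(1) growth_const_nonneg[OF \<alpha>] lip_const_nonneg[OF \<alpha>] by (simp add: C_def)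
    qed
    with bound show ?thesis by blast
  qed
  show ?thesis
    unfolding Eu Ev Du Dv bounded_iff SUP_ereal_finite_iff
    unfolding p_def[symmetric] q_def[symmetric] fun_cong[OF p_def, symmetric] fun_cong[OF q_def, symmetric]
  proof (rule iffI, goal_cases)
    case 1
    then obtain C where "0 \<le> C" "\<And>f z. f \<in> bloch_space \<alpha> \<Longrightarrow> z \<in> unit_disk \<Longrightarrow>
        norm (U z * f (\<phi> z) - V z * f (\<psi> z) + p z * weighted_deriv \<alpha> f (\<phi> z)
          - q z * weighted_deriv \<alpha> f (\<psi> z)) \<le> C * bloch_norm \<alpha> f" by blast
    from necessity[OF this] show ?case .
  next
    case 2
    then obtain P Q where "\<And>z. z \<in> unit_disk \<Longrightarrow> norm (p z - q z) \<le> Q"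
      "\<And>z. z \<in> unit_disk \<Longrightarrow> norm (q z) * \<rho> z \<le> P" by blast
    with 2 show ?case by (intro sufficiency) blast+
  qed
qed

end
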